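(* Let $\lambda>-1/2$, $\lambda\neq 0$, let $C_n^\lambda$ denote the Gegenbauer polynomials and, for integers $n\ge 0$, let \[ M_n^\lambda(s)=\int_0^1\frac{C_n^\lambda(x)\,x^{s-1}}{(1-x^2)^{3/4-\lambda/2}}\,dx, \] defined for $\Re s>0$ when $n$ is even and $\Re s>-1$ when $n$ is odd (and extended by analytic continuation). Let $\varepsilon=0$ for $n$ even and $\varepsilon=1$ for $n$ odd, and define the polynomial factor $p_n^\lambda(s)$ by \[ M_n^\lambda(s)=\frac{\Gamma\left(\frac{\lambda}{2}+\frac14\right)\Gamma\left(\frac{s+\varepsilon}{2}\right)}{2\,(n!)\,\Gamma\left(\frac{s+n+\lambda}{2}+\frac14\right)}\,p_n^\lambda(s). \] Then: (a) for $n\ge 2$, $nM_n^\lambda(s)=2(\lambda+n-1)M_{n-1}^\lambda(s+1)-(2\lambda+n-2)M_{n-2}^\lambda(s)$; (b) for $\Re s>0$ and $|t|$ sufficiently small, \[ G^\lambda(s,t)\equiv\sum_{k=0}^\infty M_k^\lambda(s)t^k=\int_0^1\frac{1}{(1-x^2)^{3/4-\lambda/2}}\frac{x^{s-1}}{(1-2tx+t^2)^\lambda}\,dx \] \[ =\frac{1}{(1+t^2)^\lambda}\frac{\Gamma\left(\frac14+\frac{\lambda}{2}\right)}{2}\left[\frac{\Gamma(\lambda)\Gamma\left(\frac s2\right)}{\Gamma\left(\frac{s+\lambda}{2}+\frac14\right)}\,{}_3F_2\left(\tfrac{\lambda+1}{2},\tfrac{\lambda}{2},\tfrac s2;\tfrac12,\tfrac{s+\lambda}{2}+\tfrac14;\tfrac{4t^2}{(1+t^2)^2}\right)\right.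 \] \[ \left.+\frac{2t\,\Gamma(\lambda+1)}{1+t^2}\frac{\Gamma\left(\frac{s+1}{2}\right)}{\Gamma\left(\frac{s+\lambda}{2}+\frac34\right)}\,{}_3F_2\left(\tfrac{\lambda+1}{2},1+\tfrac{\lambda}{2},\tfrac{s+1}{2};\tfrac32,\tfrac{s+\lambda}{2}+\tfrac34;\tfrac{4t^2}{(1+t^2)^2}\right)\right]; \] (c) $p_n^\lambda(s)$ is a polynomial in $s$ satisfying $p_n^\lambda(s)=(-1)^{\lfloor n/2\rfloor}p_n^\lambda(1-s)$; (d) the transforms satisfy the recurrence in $s$ \[ [6-4(\lambda+2\lambda n+n^2)-16s+8s(s+1)]M_n^\lambda(s)+[-9+4(n+\lambda)^2+16(s+2)-4(s+2)(s+3)]M_n^\lambda(s+2)-4(s-1)(s-2)M_n^\lambda(s-2)=0, \] with \[ M_0^\lambda(s)=\frac{\Gamma\left(\frac{\lambda}{2}+\frac14\right)\Gamma\left(\frac s2\right)}{2\Gamma\left(\frac{s+\lambda}{2}+\frac14\right)},\qquad M_1^\lambda(s)=2\lambda M_0^\lambda(s+1); \] (e) the polynomials $p_n^\lambda(s)$ have zeros only on the critical line $\Re s=1/2$.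
   Context: The Gegenbauer polynomials are $C_n^\lambda(x)=\sum_{r=0}^{\lfloor n/2\rfloor}(-1)^r\binom{n-r}{r}\binom{n-r-1+\lambda}{n-r}(2x)^{n-2r}$, equivalently generated by $(1-2xt+t^2)^{-\lambda}=\sum_{n\ge0}C_n^\lambda(x)t^n$. ${}_pF_q$ denotes the generalized hypergeometric function.
   Formalization: In (b) the closed form is multiplied by the missing constant 1/Γ(λ); as printed it is false unless Γ(λ)=1, since at t=0 it gives Γ(λ)M_0^λ(s) instead of M_0^λ(s). *)

theory Defs
  imports "HOL-Complex_Analysis.Complex_Analysis"
begin

definition gegenbauer :: "real \<Rightarrow> nat \<Rightarrow> real \<Rightarrow> real" where
  "gegenbauer lam n x =
     (\<Sum>r\<le>n div 2. (-1) ^ r * of_nat ((n - r) choose r)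
        * ((of_nat (n - r) - 1 + lam) gchoose (n - r)) * (2 * x) ^ (n - 2 * r))"

definition gegenbauer_mellin_integrand :: "real \<Rightarrow> nat \<Rightarrow> complex \<Rightarrow> real \<Rightarrow> complex" where
  "gegenbauer_mellin_integrand lam n s x =
     of_real (gegenbauer lam n x) * of_real x powr (s - 1)
       / of_real ((1 - x\<^sup>2) powr (3/4 - lam/2))"

(* The half-plane of definition Re s > 0 (n even) or Re s > -1 (n odd) is
   Re s > - of_bool (odd n). The continuation is meromorphic on the whole plane; it is
   unique because nicely_meromorphic_on also fixes the value at a pole (namely 0). *)
definition gegenbauer_mellin :: "real \<Rightarrow> nat \<Rightarrow> complex \<Rightarrow> complex" where
  "gegenbauer_mellin lam n =
     (THE F. F nicely_meromorphic_on UNIV \<and>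
        (\<forall>s. Re s > - of_bool (odd n) \<longrightarrow>
           F s = (LINT x:{0<..<1}|lborel. gegenbauer_mellin_integrand lam n s x)))"

definition gegenbauer_mellin_gf :: "real \<Rightarrow> complex \<Rightarrow> complex \<Rightarrow> complex" where
  "gegenbauer_mellin_gf lam s t = (\<Sum>k. gegenbauer_mellin lam k s * t ^ k)"

(* The defining relation
     M(s) = Gamma(lam/2 + 1/4) Gamma((s + eps)/2) / (2 n! Gamma((s + n + lam)/2 + 1/4)) p(s)
   is solved for p(s); remove_sings supplies p by continuity at the isolated points where one
   of the Gamma factors has a pole. *)
definition gegenbauer_mellin_factor :: "real \<Rightarrow> nat \<Rightarrow> complex \<Rightarrow> complex" where
  "gegenbauer_mellin_factor lam n = remove_sings (\<lambda>s.
     gegenbauer_mellin lam n s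
       * (2 * fact n * Gamma ((s + of_nat n + of_real lam) / 2 + 1/4))
       / (Gamma (of_real (lam/2 + 1/4)) * Gamma ((s + of_bool (odd n)) / 2)))"

definition hypergeo_3F2 ::
  "complex \<Rightarrow> complex \<Rightarrow> complex \<Rightarrow> complex \<Rightarrow> complex \<Rightarrow> complex \<Rightarrow> complex" where
  "hypergeo_3F2 a1 a2 a3 b1 b2 z = eval_fps (fps_hypergeo [a1, a2, a3] [b1, b2] 1) z"

end

theory Submission
  imports Defs
begin

text \<open>
  Write $\<epsilon>$ for the parity of $n$ and $p_n = (2\<lambda>)_n R_n$. The three-term recurrence of the Gegenbauer
  polynomials turns into one for the Mellin transforms which, after division by the Gamma factors, says
  \[(2\<lambda>+n+1) R_{n+2}(s) = (\<lambda>+n+1)\,\{s \mid 2\}\,R_{n+1}(s+1)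
      - (n+1)\,\tfrac12(s+n+\<lambda>+\tfrac12)\,R_n(s),\]
  with factor $s$ for even and $2$ for odd $n$. By induction this yields a lowering relation expressing $R_n$
  through $R_{n+1}(s \pm 1)$; from it one obtains a mirror image of the recurrence, which gives the
  functional equation, and the difference equation in $s$.

  Eliminating the intermediate index gives, with $x = s - \tfrac12$ and some $\<gamma> > 0$, $d > 0$,
  \[R_{n+4} = \tfrac{x}{2} R_{n+2} + \<gamma> \bigl(2 x R_{n+2} + (d^2 - x^2) R_n\bigr).\]
  For $\Re x > 0$ the quotient $G = R_n / R_{n+2}$ satisfies $\Re G > 0$ and $\Re (2x - x^2 G) \ge 0$, and these
  two inequalities propagate along the recurrence. So $R_n$ has no zero with $\Re s > \tfrac12$, and by the
  functional equation none with $\Re s < \tfrac12$ either.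

  The base of everything analytic is the Beta integral for $M_0$, known for real $s$ and extended to
  complex $s$ by expanding $x^{s-1}$ in powers of $s - s_0$.
\<close>

section \<open>The reduced polynomials\<close>

text \<open>The split into (2 lam)_n and \<open>R\<close> isolates the only factor that could make
  p_n vanish identically; the remaining denominators 2 lam + n + 1 are positive for lam > -1/2, and
  \<open>R\<close> starts from 1, 1 in both parities. The recurrence moves s together with n, so
  nothing can be followed at a fixed s. The mirror image of the recurrence serves to undo that
  shift, leaving indices of one parity and a single argument. Re G > 0 does not reproduce itself:
  the next quotient is the inverse of x/2 + gamma k with k = 2x - x^2 G + d^2 G, and the part 2x -
  x^2 G is not controlled by it. The second inequality is exactly this missing control. It survives
  because the new 2x - x^2 G is again the inverse of a sum of inverses of numbers in the right
  half-plane. On the analytic side the transform is only described as a continuation. A closed form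
  is matched with the integral in the half-plane, and uniqueness of the continuation identifies the
  two. Each identity is then checked where the Gamma factors are finite and carried to the other
  points by continuity, which is where the absence of poles enters.\<close>

fun gegenbauer_red :: "complex \<Rightarrow> nat \<Rightarrow> complex \<Rightarrow> complex" where
  "gegenbauer_red l 0 s = 1"
| "gegenbauer_red l (Suc 0) s = 1"
| "gegenbauer_red l (Suc (Suc n)) s =
     ((l + of_nat n + 1) * (if even n then s else 2) * gegenbauer_red l (Suc n) (s + 1)
       - (of_nat n + 1) * ((s + of_nat n + l + 1/2) / 2) * gegenbauer_red l n s)
     / (2 * l + of_nat n + 1)"

lemma gegenbauer_red_poly: "\<exists>P. \<forall>s. gegenbauer_red l n s = poly P s"
proof (induction n rule: induct_nat_012)
  case 0
  show ?case by (intro exI[of _ 1]) simp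
next
  case 1
  show ?case by (intro exI[of _ 1]) simp
next
  case (ge2 n)
  then obtain P Q where PQ: "\<And>s. gegenbauer_red l n s = poly P s"
    "\<And>s. gegenbauer_red l (Suc n) s = poly Q s" by blast
  show ?case
    by (intro exI[of _ "smult (1 / (2 * l + of_nat n + 1))
         (smult (l + of_nat n + 1) ((if even n then [:0, 1:] else [:2:]) * pcompose Q [:1, 1:])
          - smult ((of_nat n + 1) / 2) ([:of_nat n + l + 1/2, 1:] * P))"])
       (auto simp: PQ poly_pcompose diff_divide_distrib add_divide_distrib algebra_simps)
qed

lemma gegenbauer_red_analytic: "gegenbauer_red l n analytic_on A"
proof -
  obtain P where "\<And>s. gegenbauer_red l n s = poly P s" using gegenbauer_red_poly by blast
  hence "gegenbauer_red l n = poly P" by auto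
  moreover have "poly P holomorphic_on UNIV" by (auto simp: holomorphic_on_def field_differentiable_def intro: poly_DERIV DERIV_subset)
  ultimately have "gegenbauer_red l n analytic_on UNIV" by (simp add: analytic_on_open)
  thus ?thesis by (rule analytic_on_subset) simp
qed

lemma gegenbauer_red_rec_plus:
  assumes "2 * l + of_nat n + 1 \<noteq> 0"
  shows "(2 * l + of_nat n + 1) * gegenbauer_red l (n + 2) s =
    (l + of_nat n + 1) * (if even n then s else 2) * gegenbauer_red l (n + 1) (s + 1)
      - (of_nat n + 1) * ((s + of_nat n + l + 1/2) / 2) * gegenbauer_red l n s"
  using assms by simp

text \<open>Applying the recurrence to level n+3 at s+1 and at s-1 and combining the two with the
  weights of the claim, every term groups into the relations already known for levels n and n+1. The
  relation for level n+1 is needed at s+1, hence the induction over all s.\<close>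

lemma gegenbauer_red_lower:
  assumes l: "\<And>k. 2 * l + of_nat k + 1 \<noteq> 0"
  shows "(if even n
          then s * gegenbauer_red l (n + 1) (s + 1) + (1 - s) * gegenbauer_red l (n + 1) (s - 1)
               = (of_nat n + 1) * gegenbauer_red l n s
          else gegenbauer_red l (n + 1) (s + 1) - gegenbauer_red l (n + 1) (s - 1)
               = (of_nat n + 1) / 2 * gegenbauer_red l n s)"
proof (induction n arbitrary: s rule: induct_nat_012)
  case 0
  show ?case by simp
next
  case 1
  \<comment> \<open>This is the shape in which the simplifier meets the denominator 2l+1 of
    R_2.\<close>
  have "4 + l * 8 = 4 * (2 * l + of_nat 0 + 1)" by simp
  also have "\<dots> \<noteq> 0" using l[of 0] by (intro no_zero_divisors) simp_all
  finally have "4 + l * 8 \<noteq> 0" .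
  thus ?case by (simp add: divide_simps) (simp add: algebra_simps)
next
  case (ge2 n)
  define m where "m = (of_nat n :: complex)"
  define b where "b = gegenbauer_red l (Suc (Suc n)) s"
  define a where "a = gegenbauer_red l (Suc (Suc n)) (s + 2)"
  define a' where "a' = gegenbauer_red l (Suc (Suc n)) (s - 2)"
  define c where "c = gegenbauer_red l (Suc n) (s + 1)"
  define d where "d = gegenbauer_red l (Suc n) (s - 1)"
  define e where "e = gegenbauer_red l n s"
  define f where "f = gegenbauer_red l (Suc (Suc (Suc n))) (s + 1)"
  define g where "g = gegenbauer_red l (Suc (Suc (Suc n))) (s - 1)"
  have nz: "2 * l + m + 1 \<noteq> 0" "2 * l + m + 2 \<noteq> 0"
    using l[of n] l[of "Suc n"] by (simp_all add: m_def add_ac)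
  note R = gegenbauer_red.simps(3)
  have b_eq: "(2 * l + m + 1) * b = (l + m + 1) * (if even n then s else 2) * c
         - (m + 1) * ((s + m + l + 1/2) / 2) * e"
    using nz by (simp add: b_def R m_def c_def e_def)
  have sh: "s - 1 + 1 = s" "s + 1 + 1 = s + 2" "s + 1 - 1 = s" by simp_all
  have f_eq: "(2 * l + m + 2) * f = (l + m + 2) * (if even n then 2 else s + 1) * a
         - (m + 2) * ((s + m + l + 5/2) / 2) * c"
    using gegenbauer_red_rec_plus[OF l, of "n + 1" "s + 1"] unfolding sh f_def a_def c_def m_def
    by (simp add: add_ac del: gegenbauer_red.simps)
  have g_eq: "(2 * l + m + 2) * g = (l + m + 2) * (if even n then 2 else s - 1) * b
         - (m + 2) * ((s + m + l + 1/2) / 2) * d"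
    using gegenbauer_red_rec_plus[OF l, of "n + 1" "s - 1"] unfolding sh g_def b_def d_def m_def
    by (simp add: add_ac del: gegenbauer_red.simps)
  define h where "h = (s + m + l + 1/2) / 2"
  have u2: "(s + m + l + 5/2) / 2 = h + 1" by (simp add: h_def field_simps)
  show ?case
  proof (cases "even n")
    case True
    have 1: "s * c + (1 - s) * d = (m + 1) * e"
      using ge2.IH(1)[of s] True by (simp add: c_def d_def m_def e_def del: gegenbauer_red.simps)
    have 2: "a - b = (m + 2) / 2 * c"
      using ge2.IH(2)[of "s + 1"] True unfolding sh
      by (simp add: a_def b_def c_def m_def add_ac del: gegenbauer_red.simps)
    have "(2 * l + m + 2) * (s * f + (1 - s) * g) = (2 * l + m + 2) * ((m + 3) * b)"
    proof -
      have "(2 * l + m + 2) * (s * f + (1 - s) * g)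
          = s * ((2 * l + m + 2) * f) + (1 - s) * ((2 * l + m + 2) * g)"
        by (simp add: algebra_simps)
      also have "\<dots> = 2 * (l + m + 2) * (s * (a - b) + b)
          - (m + 2) * h * (s * c + (1 - s) * d) - (m + 2) * s * c"
        unfolding f_eq g_eq u2 h_def[symmetric] using True by (simp add: algebra_simps)
      also have "\<dots> = (l + m + 2) * (s * (m + 2) * c + 2 * b)
          - (m + 2) * ((m + 1) * h * e) - (m + 2) * s * c"
        unfolding 1 2 by (simp add: algebra_simps)
      \<comment> \<open>The recurrence for \<open>b\<close>, read backwards, trades the level-n
        value \<open>e\<close> for levels n+1 and n+2; the terms in \<open>c\<close> then
        cancel.\<close>
      also have "(m + 1) * h * e = (l + m + 1) * s * c - (2 * l + m + 1) * b"
        using b_eq True unfolding h_def[symmetric] by simp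
      finally show ?thesis by (simp add: algebra_simps)
    qed
    hence "s * f + (1 - s) * g = (m + 3) * b" using nz by simp
    thus ?thesis using True by (simp add: f_def g_def b_def m_def add_ac del: gegenbauer_red.simps)
  next
    case False
    have 1: "c - d = (m + 1) / 2 * e"
      using ge2.IH(1)[of s] False by (simp add: c_def d_def m_def e_def del: gegenbauer_red.simps)
    have 2: "(s + 1) * a - s * b = (m + 2) * c"
      using ge2.IH(2)[of "s + 1"] False unfolding sh
      by (simp add: a_def b_def c_def m_def add_ac del: gegenbauer_red.simps)
    have "(2 * l + m + 2) * (f - g) = (2 * l + m + 2) * ((m + 3) / 2 * b)"
    proof -
      have "(2 * l + m + 2) * (f - g) = (2 * l + m + 2) * f - (2 * l + m + 2) * g"
        by (rule right_diff_distrib)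
      also have "\<dots> = (l + m + 2) * (((s + 1) * a - s * b) + b)
          - (m + 2) * h * (c - d) - (m + 2) * c"
        unfolding f_eq g_eq u2 h_def[symmetric] using False by (simp add: algebra_simps)
      also have "\<dots> = (l + m + 2) * ((m + 2) * c + b)
          - (m + 2) / 2 * ((m + 1) * h * e) - (m + 2) * c"
        unfolding 1 2 by (simp add: algebra_simps)
      also have "(m + 1) * h * e = (l + m + 1) * 2 * c - (2 * l + m + 1) * b"
        using b_eq False unfolding h_def[symmetric] by simp
      finally show ?thesis by (simp add: field_simps)
    qed
    hence "f - g = (m + 3) / 2 * b" using nz by simp
    thus ?thesis using False by (simp add: f_def g_def b_def m_def add_ac del: gegenbauer_red.simps)
  qed
qed

text \<open>The right-hand sides of this and of the defining recurrence differ by l+n+1 times the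
  lowering relation (twice that for odd n). Up to signs it is the defining recurrence with s
  replaced by 1-s.\<close>

lemma gegenbauer_red_rec_minus:
  assumes l: "\<And>k. 2 * l + of_nat k + 1 \<noteq> 0"
  shows "(2 * l + of_nat n + 1) * gegenbauer_red l (n + 2) s =
    (l + of_nat n + 1) * (if even n then s - 1 else 2) * gegenbauer_red l (n + 1) (s - 1)
      + (of_nat n + 1) * ((1 - s + of_nat n + l + 1/2) / 2) * gegenbauer_red l n s"
proof -
  define c where "c = gegenbauer_red l (n + 1) (s + 1)"
  define d where "d = gegenbauer_red l (n + 1) (s - 1)"
  define e where "e = gegenbauer_red l n s"
  define m where "m = (of_nat n :: complex)"
  have L: "if even n then s * c + (1 - s) * d = (m + 1) * e else c - d = (m + 1) / 2 * e"
    using gegenbauer_red_lower[OF l, of n s] by (simp only: c_def d_def e_def m_def)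
  have "(l + m + 1) * (if even n then s else 2) * c - (m + 1) * ((s + m + l + 1/2) / 2) * e =
    (l + m + 1) * (if even n then s - 1 else 2) * d + (m + 1) * ((1 - s + m + l + 1/2) / 2) * e"
  proof (cases "even n")
    case True
    hence e: "s * c + (1 - s) * d = (m + 1) * e" using L by simp
    have "(l + m + 1) * s * c - (m + 1) * ((s + m + l + 1/2) / 2) * e =
      (l + m + 1) * (s - 1) * d + (m + 1) * ((1 - s + m + l + 1/2) / 2) * e
      + (l + m + 1) * ((s * c + (1 - s) * d) - (m + 1) * e)" by (simp add: field_simps)
    thus ?thesis using True unfolding e by simp
  next
    case False
    hence e: "c - d = (m + 1) / 2 * e" using L by simp
    have "(l + m + 1) * 2 * c - (m + 1) * ((s + m + l + 1/2) / 2) * e =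
      (l + m + 1) * 2 * d + (m + 1) * ((1 - s + m + l + 1/2) / 2) * e
      + (l + m + 1) * 2 * ((c - d) - (m + 1) / 2 * e)" by (simp add: field_simps)
    thus ?thesis using False unfolding e by simp
  qed
  thus ?thesis unfolding gegenbauer_red_rec_plus[OF l[of n]] by (simp only: c_def d_def e_def m_def)
qed

text \<open>The mirrored recurrence taken at 1-s is the defining one with the sign of the last term
  reversed and, for even n, the sign of the factor s reversed as well. The pattern (-1)^(n div 2)
  absorbs both: n and n+1 have the same sign for even n and opposite signs for odd n.\<close>

lemma gegenbauer_red_reflect:
  assumes l: "\<And>k. 2 * l + of_nat k + 1 \<noteq> 0"
  shows "gegenbauer_red l n (1 - s) = (-1) ^ (n div 2) * gegenbauer_red l n s"
proof (induction n arbitrary: s rule: induct_nat_012)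
  case (ge2 n)
  have "(2 * l + of_nat n + 1) * gegenbauer_red l (n + 2) (1 - s) =
    (l + of_nat n + 1) * (if even n then - s else 2) * gegenbauer_red l (n + 1) (1 - (s + 1))
      + (of_nat n + 1) * ((s + of_nat n + l + 1/2) / 2) * gegenbauer_red l n (1 - s)"
    using gegenbauer_red_rec_minus[OF l, of n "1 - s"] by (simp del: gegenbauer_red.simps)
  also have "\<dots> = (-1) ^ (Suc (n div 2)) * ((2 * l + of_nat n + 1) * gegenbauer_red l (n + 2) s)"
  proof (cases "even n")
    case True
    hence "Suc n div 2 = n div 2" by auto
    thus ?thesis unfolding gegenbauer_red_rec_plus[OF l[of n]] ge2.IH(1)[of s]
      using True ge2.IH(2)[of "s + 1"] by (simp add: field_simps)
  next
    case False
    hence "Suc n div 2 = Suc (n div 2)" by auto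
    thus ?thesis unfolding gegenbauer_red_rec_plus[OF l[of n]] ge2.IH(1)[of s]
      using False ge2.IH(2)[of "s + 1"] by (simp add: field_simps)
  qed
  finally have "(2 * l + of_nat n + 1) * gegenbauer_red l (n + 2) (1 - s) =
    (2 * l + of_nat n + 1) * ((-1) ^ (Suc (n div 2)) * gegenbauer_red l (n + 2) s)"
    by (simp only: mult_ac)
  hence "gegenbauer_red l (n + 2) (1 - s) = (-1) ^ (Suc (n div 2)) * gegenbauer_red l (n + 2) s"
    by (rule iffD1[OF mult_left_cancel[OF l[of n]]])
  thus ?case by (simp del: gegenbauer_red.simps)
qed auto

text \<open>Here p = l+n+1 and x = s - 1/2; \<open>a\<close>, \<open>b\<close>, \<open>c\<close> are
  the values of levels n+4, n+2, n at s, and \<open>d\<close>, \<open>e\<close> those of levels n+3,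
  n+1 at s+1, which are eliminated. The parity factors of consecutive levels are s and 2 in some
  order, so only their product 2s = 2x + 1 survives and the outcome no longer depends on parity.
  Denominators are cleared, so a commutative ring suffices.\<close>

lemma three_term_elimination:
  fixes a b c d e m p x \<sigma> \<sigma>' :: "'a :: comm_ring_1"
  assumes 1: "2 * (2 * p - m + 1) * a = 2 * (p + 2) * \<sigma> * d - (m + 3) * (p + 2 + x) * b"
    and 2: "2 * (2 * p - m) * d = 2 * (p + 1) * \<sigma>' * b + (m + 2) * (p - x) * e"
    and 3: "2 * (2 * p - m - 1) * b = 2 * p * \<sigma> * e - (m + 1) * (p + x) * c"
    and \<sigma>: "\<sigma> * \<sigma>' = 2 * x + 1"
  shows "8 * p * (2 * p - m + 1) * (2 * p - m) * a = 4 * p * (2 * p - m + 1) * (2 * p - m) * x * b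
    + 2 * (p + 2) * (m + 2) * (m + 1) * (2 * x * b + (p\<^sup>2 - x\<^sup>2) * c)"
proof -
  have e: "2 * p * \<sigma> * e = 2 * (2 * p - m - 1) * b + (m + 1) * (p + x) * c" using 3 by simp
  have "8 * p * (2 * p - m + 1) * (2 * p - m) * a = 4 * p * (2 * p - m) * (2 * (2 * p - m + 1) * a)"
    by (simp add: algebra_simps)
  also have "\<dots> = 4 * p * (p + 2) * \<sigma> * (2 * (2 * p - m) * d)
      - 4 * p * (2 * p - m) * (m + 3) * (p + 2 + x) * b"
    unfolding 1 by (simp add: algebra_simps)
  also have "\<dots> = 8 * p * (p + 2) * (p + 1) * (\<sigma> * \<sigma>') * b
      + 2 * (p + 2) * (m + 2) * (p - x) * (2 * p * \<sigma> * e)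
      - 4 * p * (2 * p - m) * (m + 3) * (p + 2 + x) * b"
    unfolding 2 by (simp add: algebra_simps)
  also have "\<dots> = 4 * p * (2 * p - m + 1) * (2 * p - m) * x * b
    + 2 * (p + 2) * (m + 2) * (m + 1) * (2 * x * b + (p\<^sup>2 - x\<^sup>2) * c)"
    unfolding e \<sigma> by (simp add: algebra_simps power2_eq_square)
  finally show ?thesis .
qed

text \<open>The recurrence leads from level n+4 at s to level n+3 at s+1, and its mirror image leads
  from there back to level n+2 at s. All three remaining terms therefore share one argument.\<close>

lemma gegenbauer_red_three_term:
  assumes l: "\<And>k. 2 * l + of_nat k + 1 \<noteq> 0" and l': "\<And>k. l + of_nat k + 1 \<noteq> 0"
  defines "\<gamma> \<equiv> \<lambda>n. (l + of_nat n + 3) * (of_nat n + 2) * (of_nat n + 1)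
       / (4 * (l + of_nat n + 1) * (2 * l + of_nat n + 3) * (2 * l + of_nat n + 2))"
  shows "gegenbauer_red l (n + 4) (x + 1/2) = x / 2 * gegenbauer_red l (n + 2) (x + 1/2)
     + \<gamma> n * (2 * x * gegenbauer_red l (n + 2) (x + 1/2)
        + ((l + of_nat n + 1)\<^sup>2 - x\<^sup>2) * gegenbauer_red l n (x + 1/2))"
proof -
  define m where "m = (of_nat n :: complex)"
  define s where "s = x + 1/2"
  define a where "a = gegenbauer_red l (n + 4) s"
  define b where "b = gegenbauer_red l (n + 2) s"
  define c where "c = gegenbauer_red l n s"
  define d where "d = gegenbauer_red l (n + 3) (s + 1)"
  define e where "e = gegenbauer_red l (n + 1) (s + 1)"
  have nz: "2 * l + m + 1 \<noteq> 0" "2 * l + m + 2 \<noteq> 0" "2 * l + m + 3 \<noteq> 0" "l + m + 1 \<noteq> 0"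
    using l[of n] l[of "n + 1"] l[of "n + 2"] l'[of n] by (simp_all add: m_def add_ac)
  have ix: "n + 4 = Suc (Suc (Suc (Suc n)))" "n + 3 = Suc (Suc (Suc n))" by simp_all
  have 1: "(2 * l + m + 3) * a = (l + m + 3) * (if even n then s else 2) * d
      - (m + 3) * ((s + m + l + 5/2) / 2) * b"
    using gegenbauer_red_rec_plus[OF l, of "n + 2" s]
    by (simp add: a_def b_def d_def m_def ix add_ac del: gegenbauer_red.simps)
  have 2: "(2 * l + m + 2) * d = (l + m + 2) * (if even n then 2 else s) * b
      + (m + 2) * ((m + l + 3/2 - s) / 2) * e"
    using gegenbauer_red_rec_minus[OF l, of "n + 1" "s + 1"]
    by (simp add: b_def e_def d_def m_def ix algebra_simps del: gegenbauer_red.simps)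
  have 3: "(2 * l + m + 1) * b = (l + m + 1) * (if even n then s else 2) * e
      - (m + 1) * ((s + m + l + 1/2) / 2) * c"
    using gegenbauer_red_rec_plus[OF l, of n s]
    by (simp add: b_def c_def e_def m_def ix add_ac del: gegenbauer_red.simps)
  \<comment> \<open>With p = l+n+1 and s = x + 1/2 the linear factors of the recurrences become p +
    x, p - x and p + 2 + x; this p is the d of the overview.\<close>
  define p where "p = l + m + 1"
  define \<sigma> \<sigma>' where "\<sigma> = (if even n then s else 2)" and "\<sigma>' = (if even n then 2 else s)"
  define w where "w = 8 * p * (2 * p - m + 1) * (2 * p - m)"
  have p: "2 * p - m + 1 = 2 * l + m + 3" "2 * p - m = 2 * l + m + 2" "2 * p - m - 1 = 2 * l + m + 1"
    "p + 2 = l + m + 3" "p + 1 = l + m + 2"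
    by (simp_all add: p_def)
  have p': "2 * l + m + 2 + 1 = 2 * l + m + 3" by simp
  have w: "w = 2 * (4 * (l + m + 1) * (2 * l + m + 3) * (2 * l + m + 2))"
  proof -
    have "(8 :: complex) = 2 * 4" by simp
    thus ?thesis unfolding w_def p p' unfolding p_def by (simp only: mult.assoc)
  qed
  have "w \<noteq> 0" unfolding w using nz by (intro no_zero_divisors) simp_all
  have halves: "(s + m + l + 5/2) / 2 = (p + 2 + x) / 2" "(s + m + l + 1/2) / 2 = (p + x) / 2"
    "(m + l + 3/2 - s) / 2 = (p - x) / 2"
    by (simp_all add: s_def p_def)
  have double: "2 * A * y = 2 * B * z + C * h * t" if "A * y = B * z + C * (h / 2) * t"
    for A B C h t y z :: complex
  proof -
    have "2 * (A * y) = 2 * (B * z) + 2 * (C * (h / 2) * t)"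
      unfolding that by (rule distrib_left)
    also have "2 * (C * (h / 2) * t) = C * h * t" by simp
    finally show ?thesis by (simp only: mult.assoc)
  qed
  have "w * a = 4 * p * (2 * p - m + 1) * (2 * p - m) * x * b
    + 2 * (p + 2) * (m + 2) * (m + 1) * (2 * x * b + (p\<^sup>2 - x\<^sup>2) * c)"
    unfolding w_def
  proof (rule three_term_elimination)
    show "\<sigma> * \<sigma>' = 2 * x + 1" by (simp add: \<sigma>_def \<sigma>'_def s_def)
    show "2 * (2 * p - m + 1) * a = 2 * (p + 2) * \<sigma> * d - (m + 3) * (p + 2 + x) * b"
      using double[of "2 * l + m + 3" a "l + m + 3" "\<sigma> * d" "- (m + 3)" "p + 2 + x" b] 1
      unfolding halves \<sigma>_def[symmetric] p(1) p(4)[symmetric] by (simp only: mult.assoc) simp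
    show "2 * (2 * p - m) * d = 2 * (p + 1) * \<sigma>' * b + (m + 2) * (p - x) * e"
      using double[of "2 * l + m + 2" d "l + m + 2" "\<sigma>' * b" "m + 2" "p - x" e] 2
      unfolding halves \<sigma>'_def[symmetric] p(2) p(5)[symmetric] by (simp only: mult.assoc)
    show "2 * (2 * p - m - 1) * b = 2 * p * \<sigma> * e - (m + 1) * (p + x) * c"
      using double[of "2 * l + m + 1" b p "\<sigma> * e" "- (m + 1)" "p + x" c] 3
      unfolding halves \<sigma>_def[symmetric] p(3) p_def[symmetric] by (simp only: mult.assoc) simp
  qed
  hence "a = (4 * p * (2 * p - m + 1) * (2 * p - m) * x * b
    + 2 * (p + 2) * (m + 2) * (m + 1) * (2 * x * b + (p\<^sup>2 - x\<^sup>2) * c)) / w"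
    using \<open>w \<noteq> 0\<close> by (simp add: nonzero_eq_divide_eq mult.commute)
  also have "\<dots> = x / 2 * b + (p + 2) * (m + 2) * (m + 1) / (4 * (l + m + 1) * (2 * l + m + 3) * (2 * l + m + 2))
      * (2 * x * b + (p\<^sup>2 - x\<^sup>2) * c)"
  proof -
    have "4 * p * (2 * p - m + 1) * (2 * p - m) * x * b = w * (x / 2 * b)" by (simp add: w_def)
    moreover have "2 * K / w = K / (4 * (l + m + 1) * (2 * l + m + 3) * (2 * l + m + 2))" for K
      unfolding w by simp
    from this[of "(p + 2) * (m + 2) * (m + 1) * (2 * x * b + (p\<^sup>2 - x\<^sup>2) * c)"]
    have "2 * (p + 2) * (m + 2) * (m + 1) * (2 * x * b + (p\<^sup>2 - x\<^sup>2) * c) / w =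
      (p + 2) * (m + 2) * (m + 1) / (4 * (l + m + 1) * (2 * l + m + 3) * (2 * l + m + 2))
      * (2 * x * b + (p\<^sup>2 - x\<^sup>2) * c)" by (simp only: mult.assoc times_divide_eq_left)
    ultimately show ?thesis using \<open>w \<noteq> 0\<close> by (simp only: add_divide_distrib) simp
  qed
  finally show ?thesis unfolding \<gamma>_def a_def b_def c_def p_def m_def s_def by (simp only: add_ac) simp
qed

text \<open>Lowering from level n at s+1 and s-1 expresses the brackets through level n-1 at s+1 and
  s-1; the recurrence and one more lowering do the same for R_n(s). The factor \<open>u\<close> is
  twice the argument of the reciprocal Gamma factor at s-2, and \<open>v\<close> is \<open>u\<close>
  with s replaced by 1-s.\<close>

lemma gegenbauer_red_difference_eq:
  assumes l: "\<And>k. 2 * l + of_nat k + 1 \<noteq> 0"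
  defines "R \<equiv> gegenbauer_red l"
  defines "u \<equiv> \<lambda>n s. s + of_nat n + l - 3/2" and "v \<equiv> \<lambda>n s. of_nat n + l - 1/2 - s"
  shows "of_nat n * (2 * l + of_nat n - 1) * R n s =
    (if even n then s * v n s * (R n (s + 2) - R n s) - (1 - s) * u n s * (R n s - R n (s - 2))
     else v n s * ((s + 1) * R n (s + 2) - s * R n s) + u n s * ((s - 1) * R n s + (2 - s) * R n (s - 2)))"
proof -
  consider "n = 0" | "n = 1" | m where "n = m + 2"
    by (metis One_nat_def add_2_eq_Suc' not0_implies_Suc)
  thus ?thesis
  proof cases
    case (3 k)
    define m where "m = (of_nat k :: complex)"
    define a where "a = gegenbauer_red l (k + 2) (s + 2)"
    define b where "b = gegenbauer_red l (k + 2) s"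
    define c where "c = gegenbauer_red l (k + 2) (s - 2)"
    define d where "d = gegenbauer_red l (k + 1) (s + 1)"
    define e where "e = gegenbauer_red l (k + 1) (s - 1)"
    define f where "f = gegenbauer_red l k s"
    have sh: "s + 1 + 1 = s + 2" "s + 1 - 1 = s" "s - 1 + 1 = s" "s - 1 - 1 = s - 2" by simp_all
    have 1: "if even k then a - b = (m + 2) / 2 * d else (s + 1) * a - s * b = (m + 2) * d"
      using gegenbauer_red_lower[OF l, of "k + 1" "s + 1"] unfolding sh
      by (cases "even k") (simp_all add: a_def b_def d_def m_def algebra_simps del: gegenbauer_red.simps)
    have 2: "if even k then b - c = (m + 2) / 2 * e else (s - 1) * b + (2 - s) * c = (m + 2) * e"
      using gegenbauer_red_lower[OF l, of "k + 1" "s - 1"] unfolding sh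
      by (cases "even k") (simp_all add: c_def b_def e_def m_def algebra_simps del: gegenbauer_red.simps)
    have 3: "(2 * l + m + 1) * b = (l + m + 1) * (if even k then s else 2) * d
        - (m + 1) * ((s + m + l + 1/2) / 2) * f"
      using gegenbauer_red_rec_plus[OF l, of k s]
      by (simp add: b_def d_def f_def m_def add_ac del: gegenbauer_red.simps)
    have 4: "if even k then s * d + (1 - s) * e = (m + 1) * f else d - e = (m + 1) / 2 * f"
      using gegenbauer_red_lower[OF l, of k s]
      by (cases "even k") (simp_all add: d_def e_def f_def m_def algebra_simps del: gegenbauer_red.simps)
    \<comment> \<open>These are the values at n = k+2 of the functions of the same names in the
      statement; the two are identified at the end.\<close>
    define u v where "u = s + m + l + 1/2" and "v = m + l + 3/2 - s"
    have "(m + 2) * (2 * l + m + 1) * b =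
     (if even k then s * v * (a - b) - (1 - s) * u * (b - c)
     else v * ((s + 1) * a - s * b) + u * ((s - 1) * b + (2 - s) * c))"
    proof (cases "even k")
      case True
      hence f: "(m + 1) * f = s * d + (1 - s) * e" and a: "a - b = (m + 2) / 2 * d"
        and c: "b - c = (m + 2) / 2 * e" using 1 2 4 by simp_all
      have "(2 * l + m + 1) * b = (l + m + 1) * s * d - (u / 2) * ((m + 1) * f)"
        using 3 True by (simp add: u_def algebra_simps)
      also have "\<dots> = s * v / 2 * d - (1 - s) * u / 2 * e"
        unfolding f u_def v_def by (simp add: field_simps)
      finally have b: "(m + 2) * ((2 * l + m + 1) * b) = (m + 2) * (s * v / 2 * d - (1 - s) * u / 2 * e)"
        by simp
      show ?thesis using True b unfolding a c by (simp add: algebra_simps)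
    next
      case False
      hence "(m + 1) / 2 * f = d - e" and a: "(s + 1) * a - s * b = (m + 2) * d"
        and c: "(s - 1) * b + (2 - s) * c = (m + 2) * e" using 1 2 4 by simp_all
      hence f: "(m + 1) * f = 2 * (d - e)" by (simp add: field_simps)
      have "(2 * l + m + 1) * b = (l + m + 1) * 2 * d - (u / 2) * ((m + 1) * f)"
        using 3 False by (simp add: u_def algebra_simps)
      also have "\<dots> = v * d + u * e"
        unfolding f u_def v_def by (simp add: field_simps)
      finally have b: "(m + 2) * ((2 * l + m + 1) * b) = (m + 2) * (v * d + u * e)"
        by simp
      show ?thesis using False b unfolding a c by (simp add: algebra_simps)
    qed
    moreover have "of_nat n = m + 2" "2 * l + (m + 2) - 1 = 2 * l + m + 1"
      "s + (m + 2) + l - 3/2 = u" "m + 2 + l - 1/2 - s = v" "even n = even k"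
      by (simp_all add: \<open>n = k + 2\<close> m_def u_def v_def)
    moreover have "R n (s + 2) = a" "R n s = b" "R n (s - 2) = c"
      by (simp_all only: \<open>n = k + 2\<close> R_def a_def b_def c_def)
    ultimately show ?thesis unfolding assms(3,4) by (simp only:)
  qed (auto simp: R_def u_def v_def algebra_simps)
qed

section \<open>Zero-free right half-plane\<close>

lemma Re_inverse_pos: "Re z > 0 \<Longrightarrow> Re (inverse z) > 0"
  by (auto simp: Re_divide inverse_eq_divide intro!: divide_pos_pos add_pos_nonneg)

lemma gegenbauer_red_2:
  assumes "2 * l + 1 \<noteq> 0"
  shows "gegenbauer_red l (Suc (Suc 0)) s = (s - 1/2) / 2"
proof -
  have "(l + 1) * s - (s + l + 1/2) / 2 = (2 * l + 1) * ((s - 1/2) / 2)"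
    by (simp add: field_simps)
  thus ?thesis using assms by simp
qed

lemma gegenbauer_red_3:
  assumes "2 * l + 1 \<noteq> 0" "2 * l + 2 \<noteq> 0"
  shows "gegenbauer_red l (Suc (Suc (Suc 0))) s = (s - 1/2) / 2"
proof -
  have "gegenbauer_red l (Suc (Suc (Suc 0))) s
      = ((l + 2) * 2 * gegenbauer_red l (Suc (Suc 0)) (s + 1) - 2 * ((s + 1 + l + 1/2) / 2)) / (2 * l + 2)"
    by (subst gegenbauer_red.simps(3)) (simp add: add_ac del: gegenbauer_red.simps(3))
  also have "\<dots> = (2 * l + 2) * ((s - 1/2) / 2) / (2 * l + 2)"
    unfolding gegenbauer_red_2[OF assms(1)] by (intro arg_cong2[where f = "(/)"] refl) (simp add: field_simps)
  also have "\<dots> = (s - 1/2) / 2" using assms(2) by (rule nonzero_mult_div_cancel_left)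
  finally show ?thesis .
qed

text \<open>Only the hypothesis at n is used to reach n+2, so the two parities evolve separately.
  Both start from R_0 / R_2 = R_1 / R_3 = 2/x, where the last expression equals 0; hence that
  inequality cannot be strict.\<close>

lemma gegenbauer_red_right_half_plane:
  assumes lam: "lam > -1/2" and x: "Re x > 0"
  defines "R \<equiv> \<lambda>n. gegenbauer_red (of_real lam) n (x + 1/2)"
  shows "R (n + 2) \<noteq> 0 \<and> Re (R n / R (n + 2)) > 0 \<and> Re (2 * x - x\<^sup>2 * (R n / R (n + 2))) \<ge> 0"
proof -
  have nz: "2 * of_real lam + of_nat k + 1 \<noteq> (0 :: complex)" "of_real lam + of_nat k + 1 \<noteq> (0 :: complex)" for k
  proof -
    have "2 * of_real lam + of_nat k + 1 = complex_of_real (2 * lam + real k + 1)"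
      "of_real lam + of_nat k + 1 = complex_of_real (lam + real k + 1)" by simp_all
    thus "2 * of_real lam + of_nat k + 1 \<noteq> (0 :: complex)" "of_real lam + of_nat k + 1 \<noteq> (0 :: complex)"
      using lam by (simp_all only: of_real_eq_0_iff)
  qed
  show ?thesis
  proof (induction n rule: induct_nat_012)
    case 0
    have R2: "R (Suc (Suc 0)) = x / 2"
      using gegenbauer_red_2[of "of_real lam" "x + 1/2"] nz[of 0] by (simp add: R_def)
    moreover have "x \<noteq> 0" using x by auto
    moreover have "Re (2 / x) > 0" using Re_inverse_pos[OF x] by (simp add: divide_inverse)
    moreover have "R 0 = 1" by (simp add: R_def)
    ultimately show ?case by (simp add: R2 power2_eq_square)
  next
    case 1
    have R3: "R (Suc (Suc (Suc 0))) = x / 2"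
      using gegenbauer_red_3[of "of_real lam" "x + 1/2"] nz[of 0] nz[of 1]
      by (simp add: R_def add_ac)
    moreover have "x \<noteq> 0" using x by auto
    moreover have "Re (2 / x) > 0" using Re_inverse_pos[OF x] by (simp add: divide_inverse)
    moreover have "R 1 = 1" by (simp add: R_def)
    ultimately show ?case by (simp add: R3 power2_eq_square)
  next
    case (ge2 n)
    define d where "d = lam + real n + 1"
    define \<gamma> where "\<gamma> = (lam + real n + 3) * (real n + 2) * (real n + 1)
         / (4 * (lam + real n + 1) * (2 * lam + real n + 3) * (2 * lam + real n + 2))"
    have d: "d > 0" using lam by (simp add: d_def)
    have \<gamma>: "\<gamma> > 0"
      unfolding \<gamma>_def using lam by (intro divide_pos_pos mult_pos_pos) auto
    define G where "G = R n / R (n + 2)"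
    have G: "R (n + 2) \<noteq> 0" "Re G > 0" "Re (2 * x - x\<^sup>2 * G) \<ge> 0"
      using ge2.IH(1) by (simp_all add: G_def)
    \<comment> \<open>The two inequalities are used in this grouping: 2x - x^2 G has nonnegative
      real part and d^2 G has positive real part.\<close>
    define k where "k = 2 * x - x\<^sup>2 * G + of_real (d\<^sup>2) * G"
    have "Re k = Re (2 * x - x\<^sup>2 * G) + d\<^sup>2 * Re G" by (simp add: k_def)
    hence k: "Re k > 0" using G d by (simp add: add_nonneg_pos)
    define T where "T = x / 2 + of_real \<gamma> * k"
    have T: "Re T > 0" using x k \<gamma> by (simp add: T_def add_pos_pos)
    have nz': "x \<noteq> 0" "k \<noteq> 0" "T \<noteq> 0" using x k T by auto
    have R4: "R (n + 4) = R (n + 2) * T"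
    proof -
      have R0: "R n = R (n + 2) * G" using G(1) by (simp add: G_def)
      have "R (n + 4) = x / 2 * R (n + 2)
       + of_real \<gamma> * (2 * x * R (n + 2) + ((of_real d)\<^sup>2 - x\<^sup>2) * R n)"
        unfolding R_def gegenbauer_red_three_term[OF nz] by (simp add: \<gamma>_def d_def)
      also have "\<dots> = R (n + 2) * T"
        unfolding T_def k_def R0 by (simp add: algebra_simps)
      finally show ?thesis .
    qed
    have G': "R (n + 2) / R (n + 4) = inverse T"
      unfolding R4 using G(1) by (simp add: field_simps)
    \<comment> \<open>Parallel sum of 4 gamma k and 2x: their sum is 4 T, their product 8 gamma k x,
      and 2x - x^2/T = 2 gamma k x / T. Inversion and addition both preserve the right
      half-plane.\<close>
    have "2 * x - x\<^sup>2 * inverse T = inverse (inverse (of_real (4 * \<gamma>) * k) + inverse (2 * x))"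
    proof -
      have "inverse (of_real (4 * \<gamma>) * k) + inverse (2 * x) = T / (2 * x * of_real \<gamma> * k)"
        using nz' \<gamma> unfolding T_def by (simp add: field_simps)
      moreover have "2 * x - x\<^sup>2 * inverse T = (2 * x * of_real \<gamma> * k) / T"
      proof -
        have "2 * x * T - x\<^sup>2 = 2 * x * of_real \<gamma> * k"
          by (simp add: T_def algebra_simps power2_eq_square)
        thus ?thesis using nz' by (simp add: divide_simps)
      qed
      ultimately show ?thesis by simp
    qed
    moreover have "Re (inverse (inverse (of_real (4 * \<gamma>) * k) + inverse (2 * x))) > 0"
    proof -
      have "Re (inverse (of_real (4 * \<gamma>) * k)) > 0" "Re (inverse (2 * x)) > 0"
        using k \<gamma> x by (intro Re_inverse_pos, simp)+
      thus ?thesis by (intro Re_inverse_pos) (simp only: plus_complex.sel add_pos_pos)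
    qed
    ultimately have "Re (2 * x - x\<^sup>2 * (R (n + 2) / R (n + 4))) \<ge> 0" unfolding G' by simp
    moreover have "Re (R (n + 2) / R (n + 4)) > 0" unfolding G' by (intro Re_inverse_pos T)
    moreover have "R (n + 4) \<noteq> 0" unfolding R4 using G(1) nz' by simp
    moreover have "n + 4 = Suc (Suc n) + 2" "n + 2 = Suc (Suc n)" by simp_all
    ultimately show ?case by simp
  qed
qed

lemma gegenbauer_red_zeros:
  assumes lam: "lam > -1/2" and zero: "gegenbauer_red (of_real lam) n s = 0"
  shows "Re s = 1/2"
proof -
  have nz: "2 * of_real lam + of_nat k + 1 \<noteq> (0 :: complex)" for k
  proof -
    have "2 * of_real lam + of_nat k + 1 = complex_of_real (2 * lam + real k + 1)" by simp
    thus ?thesis using lam by (simp only: of_real_eq_0_iff)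
  qed
  have *: "\<not> Re s > 1/2" if "gegenbauer_red (of_real lam) n s = 0" for s
  proof
    assume s: "Re s > 1/2"
    consider "n = 0" | "n = 1" | m where "n = m + 2"
      by (metis One_nat_def add_2_eq_Suc' not0_implies_Suc)
    thus False
    proof cases
      case (3 m)
      have "Re (s - 1/2) > 0" using s by simp
      from gegenbauer_red_right_half_plane[OF lam this, of m] that show False
        unfolding 3 by (simp del: gegenbauer_red.simps)
    qed (use that in auto)
  qed
  have "gegenbauer_red (of_real lam) n (1 - s) = 0"
    using gegenbauer_red_reflect[OF nz, of n s] zero by simp
  from *[OF this] *[OF zero] show ?thesis by simp
qed

section \<open>The Beta integral\<close>

text \<open>Dominated convergence with \<open>g\<close> bounding all partial sums of norms. It
  serves for the expansion in s and for both expansions of the generating function; the absolute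
  summability of the integrals is what later allows splitting a series by parity.\<close>

lemma set_integral_sums_dominated:
  fixes f :: "nat \<Rightarrow> 'a \<Rightarrow> 'b :: {banach, second_countable_topology}"
  assumes A: "A \<in> sets M"
    and f: "\<And>k. set_borel_measurable M A (f k)" and g: "set_integrable M A g"
    and sums: "\<And>x. x \<in> A \<Longrightarrow> (\<lambda>k. f k x) sums F x"
    and bound: "\<And>x n. x \<in> A \<Longrightarrow> (\<Sum>k<n. norm (f k x)) \<le> g x"
  shows "set_integrable M A F" and "(\<lambda>k. LINT x:A|M. f k x) sums (LINT x:A|M. F x)"
    and "summable (\<lambda>k. norm (LINT x:A|M. f k x))"
proof -
  have f_int: "set_integrable M A (f k)" for k
  proof (rule set_integrable_bound[OF g f], rule AE_I2, rule impI)
    fix x assume x: "x \<in> A"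
    have "norm (f k x) \<le> (\<Sum>k<Suc k. norm (f k x))" by (simp add: sum_nonneg)
    also have "\<dots> \<le> g x" by (rule bound[OF x])
    finally show "norm (f k x) \<le> norm (g x)" by simp
  qed
  define S where "S n x = (\<Sum>k<n. indicator A x *\<^sub>R f k x)" for n x
  have lim: "(\<lambda>n. S n x) \<longlonglongrightarrow> indicator A x *\<^sub>R F x" for x
    using sums[of x] by (cases "x \<in> A") (simp_all add: S_def sums_def)
  have meas: "S n \<in> borel_measurable M" for n
    unfolding S_def using f_int[unfolded set_integrable_def]
    by (intro borel_measurable_sum borel_measurable_integrable)
  have meas': "(\<lambda>x. indicator A x *\<^sub>R F x) \<in> borel_measurable M"
    by (rule borel_measurable_LIMSEQ_metric[OF meas lim])
  have bd: "norm (S n x) \<le> indicator A x *\<^sub>R g x" for n x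
  proof (cases "x \<in> A")
    case True
    have "norm (S n x) \<le> (\<Sum>k<n. norm (f k x))"
      using True by (simp add: S_def norm_sum)
    with bound[OF True, of n] True show ?thesis by simp
  qed (simp add: S_def)
  have g': "integrable M (\<lambda>x. indicator A x *\<^sub>R g x)" using g by (simp add: set_integrable_def)
  note dc = meas' meas g' AE_I2[OF lim] AE_I2[OF bd]
  show "set_integrable M A F" unfolding set_integrable_def by (rule integrable_dominated_convergence[OF dc])
  have "(\<lambda>n. integral\<^sup>L M (S n)) \<longlonglongrightarrow> (\<integral>x. indicator A x *\<^sub>R F x \<partial>M)"
    by (rule integral_dominated_convergence[OF dc])
  moreover have "integral\<^sup>L M (S n) = (\<Sum>k<n. LINT x:A|M. f k x)" for n
    unfolding S_def set_lebesgue_integral_def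
    by (rule Bochner_Integration.integral_sum) (use f_int in \<open>simp add: set_integrable_def\<close>)
  ultimately show "(\<lambda>k. LINT x:A|M. f k x) sums (LINT x:A|M. F x)"
    by (simp add: sums_def set_lebesgue_integral_def)
  show "summable (\<lambda>k. norm (LINT x:A|M. f k x))"
  proof (rule summableI_nonneg_bounded)
    fix n
    have f_int': "integrable M (\<lambda>x. indicator A x *\<^sub>R f k x)" for k
      using f_int by (simp add: set_integrable_def)
    have "(\<Sum>k<n. norm (LINT x:A|M. f k x)) \<le> (\<Sum>k<n. \<integral>x. norm (indicator A x *\<^sub>R f k x) \<partial>M)"
      unfolding set_lebesgue_integral_def by (intro sum_mono integral_norm_bound)
    also have "\<dots> = (\<integral>x. (\<Sum>k<n. norm (indicator A x *\<^sub>R f k x)) \<partial>M)"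
      by (intro Bochner_Integration.integral_sum[symmetric] integrable_norm f_int')
    also have "\<dots> \<le> (\<integral>x. indicator A x *\<^sub>R g x \<partial>M)"
    proof (rule integral_mono[OF _ g'])
      show "integrable M (\<lambda>x. \<Sum>k<n. norm (indicator A x *\<^sub>R f k x))"
        by (intro Bochner_Integration.integrable_sum integrable_norm f_int')
      show "(\<Sum>k<n. norm (indicator A x *\<^sub>R f k x)) \<le> indicator A x *\<^sub>R g x" for x
        using bound[of x n] by (cases "x \<in> A") simp_all
    qed
    finally show "(\<Sum>k<n. norm (LINT x:A|M. f k x)) \<le> (\<integral>x. indicator A x *\<^sub>R g x \<partial>M)" .
  qed simp
qed

text \<open>With u = s - s0, x powr (s-1) = x powr (s0-1) * exp (u ln x). Since ln x < 0 on the
  interval, the partial sums of norms are at most x powr (s0-1) * exp (norm u * abs (ln x)) = x powr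
  (s0 - norm u - 1), which is integrable against the weight because norm u < s0.\<close>

lemma mellin_power_series:
  fixes w :: "real \<Rightarrow> real" and s0 :: real and s :: complex
  assumes w_meas: "w \<in> borel_measurable borel" and w_nonneg: "\<And>x. w x \<ge> 0"
    and w_int: "\<And>p. p > 0 \<Longrightarrow> set_integrable lborel {0<..<1} (\<lambda>x. x powr (p - 1) * w x)"
    and s: "dist s (of_real s0) < s0"
  shows "set_integrable lborel {0<..<1} (\<lambda>x. of_real x powr (s - 1) * of_real (w x))"
    and "(\<lambda>k. (LINT x:{0<..<1}|lborel. of_real (x powr (s0 - 1) * w x * ln x ^ k / fact k)) * (s - of_real s0) ^ k)
           sums (LINT x:{0<..<1}|lborel. of_real x powr (s - 1) * of_real (w x))"
proof -
  define u where "u = s - of_real s0"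
  define g where "g x = x powr (s0 - norm u - 1) * w x" for x
  define f where "f k x = complex_of_real (x powr (s0 - 1) * w x * ln x ^ k / fact k) * u ^ k" for k x
  have f_meas: "set_borel_measurable lborel {0<..<1} (f k)" for k
    unfolding f_def set_borel_measurable_def using w_meas by simp
  have g: "set_integrable lborel {0<..<1} g"
    unfolding g_def using s by (intro w_int) (simp add: u_def dist_norm)
  have sums: "(\<lambda>k. f k x) sums (of_real x powr (s - 1) * of_real (w x))" if "x \<in> {0<..<1}" for x
  proof -
    have "(\<lambda>k. (of_real (ln x) * u) ^ k /\<^sub>R fact k) sums exp (of_real (ln x) * u)"
      by (rule exp_converges)
    hence "(\<lambda>k. of_real (x powr (s0 - 1) * w x) * ((of_real (ln x) * u) ^ k /\<^sub>R fact k)) sums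
        (of_real (x powr (s0 - 1) * w x) * exp (of_real (ln x) * u))"
      by (rule sums_mult)
    moreover have "of_real (x powr (s0 - 1)) * exp (of_real (ln x) * u) = of_real x powr (s - 1)"
      using that by (simp add: powr_def u_def exp_of_real[symmetric] exp_add[symmetric] Ln_of_real algebra_simps)
    ultimately show ?thesis
      by (simp add: f_def power_mult_distrib scaleR_conv_of_real field_simps)
  qed
  have bound: "(\<Sum>k<n. norm (f k x)) \<le> g x" if x: "x \<in> {0<..<1}" for x n
  proof -
    have "(\<lambda>k. (norm u * \<bar>ln x\<bar>) ^ k /\<^sub>R fact k) sums exp (norm u * \<bar>ln x\<bar>)"
      by (rule exp_converges)
    hence "(\<lambda>k. x powr (s0 - 1) * w x * ((norm u * \<bar>ln x\<bar>) ^ k /\<^sub>R fact k)) sums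
        (x powr (s0 - 1) * w x * exp (norm u * \<bar>ln x\<bar>))" by (rule sums_mult)
    moreover have "x powr (s0 - 1) * w x * exp (norm u * \<bar>ln x\<bar>) = g x"
      using x by (simp add: powr_def g_def exp_add[symmetric] algebra_simps)
    moreover have "(\<lambda>k. x powr (s0 - 1) * w x * ((norm u * \<bar>ln x\<bar>) ^ k /\<^sub>R fact k)) = (\<lambda>k. norm (f k x))"
      using w_nonneg[of x]
      by (auto simp: f_def norm_mult norm_power norm_divide abs_mult power_abs power_mult_distrib field_simps)
    ultimately have "(\<lambda>k. norm (f k x)) sums g x" by simp
    thus ?thesis using sum_le_suminf[of "\<lambda>k. norm (f k x)" "{..<n}"]
      by (auto simp: sums_iff)
  qed
  note * = set_integral_sums_dominated[OF _ f_meas g sums bound]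
  show "set_integrable lborel {0<..<1} (\<lambda>x. of_real x powr (s - 1) * of_real (w x))"
    by (rule *(1)) auto
  have "(\<lambda>k. LINT x:{0<..<1}|lborel. f k x) sums (LINT x:{0<..<1}|lborel. of_real x powr (s - 1) * of_real (w x))"
    by (rule *(2)) auto
  thus "(\<lambda>k. (LINT x:{0<..<1}|lborel. of_real (x powr (s0 - 1) * w x * ln x ^ k / fact k)) * (s - of_real s0) ^ k)
           sums (LINT x:{0<..<1}|lborel. of_real x powr (s - 1) * of_real (w x))"
    unfolding f_def u_def by simp
qed

text \<open>The Beta integral under the substitution t = x^2; its Jacobian 2x turns the exponent p/2
  - 1 into p - 1.\<close>

lemma beta_integral_square_real:
  fixes p a :: real
  assumes "p > 0" "a > 0"
  shows "set_integrable lborel {0<..<1} (\<lambda>x. x powr (p - 1) * (1 - x\<^sup>2) powr (a - 1))"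
    and "(LINT x:{0<..<1}|lborel. x powr (p - 1) * (1 - x\<^sup>2) powr (a - 1)) = Beta (p / 2) a / 2"
proof -
  define f where "f t = t powr (p / 2 - 1) * (1 - t) powr (a - 1)" for t :: real
  define h where "h x = x powr (p - 1) * (1 - x\<^sup>2) powr (a - 1)" for x :: real
  have sq: "power2 ` {0<..<1::real} = {0<..<1}"
  proof (intro equalityI subsetI)
    fix y :: real assume "y \<in> {0<..<1}"
    thus "y \<in> power2 ` {0<..<1}" by (intro image_eqI[of _ _ "sqrt y"]) auto
  qed (auto simp: power_less_one_iff abs_square_less_1)
  have "(f has_integral Beta (p / 2) a) {0..1}"
    unfolding f_def using assms by (intro has_integral_Beta_real) auto
  hence hi: "(f has_integral Beta (p / 2) a) {0<..<1}"
    by (simp add: has_integral_Icc_iff_Ioo)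
  hence "f absolutely_integrable_on {0<..<1} \<and> integral {0<..<1} f = Beta (p / 2) a"
    by (auto intro!: nonnegative_absolutely_integrable_1 simp: f_def)
  hence "(\<lambda>x. \<bar>2 * x\<bar> * f (x\<^sup>2)) absolutely_integrable_on {0<..<1} \<and>
      integral {0<..<1} (\<lambda>x. \<bar>2 * x\<bar> * f (x\<^sup>2)) = Beta (p / 2) a"
    by (subst has_absolute_integral_change_of_variables_1')
       (auto simp: sq inj_on_def power2_eq_iff intro!: derivative_eq_intros)
  moreover have eq: "\<bar>2 * x\<bar> * f (x\<^sup>2) = 2 * h x" if "x \<in> {0<..<1}" for x
  proof -
    have "x * (x\<^sup>2) powr (p / 2 - 1) = x powr 1 * x powr (2 * (p / 2 - 1))"
    proof -
      have "x\<^sup>2 = x powr 2" using that by simp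
      moreover have "x powr 1 = x" using that by simp
      ultimately show ?thesis by (simp only: powr_powr)
    qed
    also have "\<dots> = x powr (1 + 2 * (p / 2 - 1))" by (rule powr_add[symmetric])
    also have "1 + 2 * (p / 2 - 1) = p - 1" by simp
    finally have "x powr (p - 1) = x * (x\<^sup>2) powr (p / 2 - 1)" ..
    moreover have "\<bar>2 * x\<bar> = 2 * x" using that by simp
    ultimately show ?thesis unfolding f_def h_def by (simp only: mult.assoc)
  qed
  ultimately have *: "(\<lambda>x. 2 * h x) absolutely_integrable_on {0<..<1}"
    "integral {0<..<1} (\<lambda>x. 2 * h x) = Beta (p / 2) a"
    by (simp_all only: set_integrable_cong[OF refl refl eq] Henstock_Kurzweil_Integration.integral_cong[OF eq])
  \<comment> \<open>\<open>absolutely_integrable_on\<close> refers to the completed measure; Borel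
    measurability of \<open>h\<close> permits the return to \<open>lborel\<close>.\<close>
  have "set_integrable lborel {0<..<1} (\<lambda>x. 2 * h x)"
    using *(1) unfolding set_integrable_def
    by (subst (asm) integrable_completion) (simp_all add: h_def)
  hence h: "set_integrable lborel {0<..<1} h" by simp
  have "(LINT x:{0<..<1}|lborel. 2 * h x) = Beta (p / 2) a"
    using set_borel_integral_eq_integral(2)[OF \<open>set_integrable lborel {0<..<1} (\<lambda>x. 2 * h x)\<close>] *(2) by simp
  hence "(LINT x:{0<..<1}|lborel. h x) = Beta (p / 2) a / 2" by simp
  with h show "set_integrable lborel {0<..<1} (\<lambda>x. x powr (p - 1) * (1 - x\<^sup>2) powr (a - 1))"
    "(LINT x:{0<..<1}|lborel. x powr (p - 1) * (1 - x\<^sup>2) powr (a - 1)) = Beta (p / 2) a / 2"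
    unfolding h_def by simp_all
qed

text \<open>Both sides are holomorphic on a disc centred at s0 > 0 that touches the imaginary axis,
  and they agree on its real diameter. Such discs exhaust the half-plane Re s > 0.\<close>

lemma beta_integral_square:
  fixes s :: complex and a :: real
  assumes s: "Re s > 0" and a: "a > 0"
  defines "F \<equiv> \<lambda>s x. of_real x powr (s - 1) * complex_of_real ((1 - x\<^sup>2) powr (a - 1))"
  shows "set_integrable lborel {0<..<1} (F s)"
    and "(LINT x:{0<..<1}|lborel. F s x) = Gamma (of_real a) * Gamma (s / 2) * rGamma (s / 2 + of_real a) / 2"
proof -
  define w where "w x = (1 - x\<^sup>2) powr (a - 1)" for x :: real
  \<comment> \<open>The disc of centre and radius s0 contains s iff (norm s)^2 < 2 * s0 * Re s; this
    choice gives s0 * Re s = (norm s)^2 + Re s.\<close>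
  define s0 where "s0 = (norm s)\<^sup>2 / Re s + 1"
  have s0: "s0 > 0" using s by (simp add: s0_def add_nonneg_pos)
  have in_ball: "dist s (of_real s0) < s0"
  proof -
    have "(dist s (of_real s0))\<^sup>2 = (norm s)\<^sup>2 - 2 * s0 * Re s + s0\<^sup>2"
      by (simp add: dist_norm cmod_power2) (simp add: power2_eq_square algebra_simps)
    also have "\<dots> < s0\<^sup>2"
    proof -
      have "s0 * Re s = (norm s)\<^sup>2 + Re s" using s by (simp add: s0_def field_simps)
      thus ?thesis using s zero_le_power2[of "norm s"] by linarith
    qed
    finally show ?thesis using s0 power_less_imp_less_base[of _ 2 s0] by simp
  qed
  have w: "w \<in> borel_measurable borel" "\<And>x. w x \<ge> 0"
    "\<And>p. p > 0 \<Longrightarrow> set_integrable lborel {0<..<1} (\<lambda>x. x powr (p - 1) * w x)"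
    unfolding w_def using a by (auto intro: beta_integral_square_real)
  note ps = mellin_power_series[OF w]
  show "set_integrable lborel {0<..<1} (F s)"
    using ps(1)[OF _ in_ball] by (simp add: F_def w_def)
  define I where "I z = (LINT x:{0<..<1}|lborel. F z x)" for z
  define J where "J z = Gamma (of_real a) * Gamma (z / 2) * rGamma (z / 2 + of_real a) / 2" for z :: complex
  have pos: "Re z > 0" if "z \<in> ball (of_real s0) s0" for z
  proof -
    have "\<bar>s0 - Re z\<bar> < s0"
      using that abs_Re_le_cmod[of "of_real s0 - z"] by (simp add: dist_norm)
    thus ?thesis by linarith
  qed
  have "I holomorphic_on ball (of_real s0) s0"
    by (rule power_series_holomorphic, unfold I_def F_def, rule ps(2)[unfolded w_def])
       (auto simp: dist_commute)
  moreover have "J holomorphic_on ball (of_real s0) s0"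
    unfolding J_def
  proof (intro holomorphic_intros)
    fix z :: complex assume "z \<in> ball (of_real s0) s0"
    from pos[OF this] show "z / 2 \<notin> \<int>\<^sub>\<le>\<^sub>0" by (auto elim!: nonpos_Ints_cases)
  qed auto
  ultimately have hol: "(\<lambda>z. I z - J z) holomorphic_on ball (of_real s0) s0"
    by (intro holomorphic_intros)
  have real: "I (of_real p) - J (of_real p) = 0" if p: "p > 0" for p
  proof -
    have "I (of_real p) = (LINT x:{0<..<1}|lborel. of_real (x powr (p - 1) * (1 - x\<^sup>2) powr (a - 1)))"
      unfolding I_def F_def
      by (intro set_lebesgue_integral_cong) (auto simp: powr_of_real[symmetric])
    also have "\<dots> = of_real (Beta (p / 2) a / 2)"
      unfolding set_integral_complex_of_real by (simp only: beta_integral_square_real[OF p a])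
    also have "\<dots> = J (of_real p)"
    proof -
      have "complex_of_real p / 2 = of_real (p / 2)" by simp
      thus ?thesis unfolding J_def Beta_altdef
        by (simp only: of_real_add[symmetric] Gamma_complex_of_real rGamma_complex_of_real) simp
    qed
    finally show ?thesis by simp
  qed
  have "I s - J s = 0"
  proof (rule analytic_continuation[OF hol])
    show "complex_of_real s0 islimpt (of_real ` {0<..<2 * s0})"
    proof (unfold islimpt_approachable, intro allI impI)
      fix e :: real assume e: "e > 0"
      define d where "d = min (e / 2) (s0 / 2)"
      have d: "d > 0" "d < e" "d < s0" using e s0 by (auto simp: d_def)
      show "\<exists>x'\<in>of_real ` {0<..<2 * s0}. x' \<noteq> complex_of_real s0 \<and> dist x' (of_real s0) < e"
        using d s0 by (intro bexI[of _ "of_real (s0 + d)"])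
           (auto simp: dist_of_real dist_real_def simp del: of_real_add)
    qed
    show "complex_of_real ` {0<..<2 * s0} \<subseteq> ball (of_real s0) s0"
      by (auto simp: dist_of_real dist_real_def)
    show "s \<in> ball (of_real s0) s0" using in_ball by (simp add: dist_commute)
  qed (use s0 real in auto)
  thus "(LINT x:{0<..<1}|lborel. F s x) = Gamma (of_real a) * Gamma (s / 2) * rGamma (s / 2 + of_real a) / 2"
    by (simp add: I_def J_def)
qed

section \<open>Mellin transforms of Gegenbauer polynomials\<close>

text \<open>The identity holds term by term once r is shifted: term r+1 of index n+2 and term r of
  index n carry the same power of x, and so does x times term r+1 of index n+1. The rest is
  absorption for binomial coefficients and the ratio of consecutive values of
  \<open>c\<close>.\<close>

lemma gegenbauer_recurrence:
  "(real n + 2) * gegenbauer lam (n + 2) x =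
     2 * (lam + real n + 1) * x * gegenbauer lam (n + 1) x - (2 * lam + real n) * gegenbauer lam n x"
proof -
  define c where "c m = (of_nat m - 1 + lam) gchoose m" for m
  \<comment> \<open>The binomial coefficient vanishes for \<open>n < 2 * r\<close>, so the sums for all three indices may share one range.\<close>
  define T where "T n r = (-1) ^ r * of_nat ((n - r) choose r) * c (n - r) * (2 * x) ^ (n - 2 * r)" for n r
  have c_Suc: "(real m + 1) * c (Suc m) = (lam + real m) * c m" for m
    by (simp add: c_def gbinomial_pochhammer' pochhammer_Suc divide_simps)
  have ext: "gegenbauer lam n x = (\<Sum>r\<le>K. T n r)" if "n \<le> K" for n K
    unfolding gegenbauer_def
  proof (rule sum.mono_neutral_cong_left)
    show "\<forall>r\<in>{..K} - {..n div 2}. T n r = 0" by (auto simp: T_def)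
    show "{..n div 2} \<subseteq> {..K}" using that by auto
  qed (auto simp: T_def c_def)
  have T0: "(real n + 2) * T (n + 2) 0 = 2 * (lam + real n + 1) * x * T (n + 1) 0"
  proof -
    have "(real n + 2) * T (n + 2) 0 = ((real (n + 1) + 1) * c (Suc (n + 1))) * (2 * x) * (2 * x) ^ (n + 1)"
      by (simp add: T_def)
    also have "\<dots> = 2 * (lam + real n + 1) * x * T (n + 1) 0"
      unfolding c_Suc by (simp add: T_def add_ac)
    finally show ?thesis .
  qed
  have TSuc: "(real n + 2) * T (n + 2) (Suc r) =
      2 * (lam + real n + 1) * x * T (n + 1) (Suc r) - (2 * lam + real n) * T n r" for r
  proof (cases "2 * r \<le> n")
    case False
    hence "(n + 2 - Suc r) choose Suc r = 0" "(n + 1 - Suc r) choose Suc r = 0" "(n - r) choose r = 0"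
      by (intro binomial_eq_0; linarith)+
    thus ?thesis by (simp only: T_def of_nat_0 mult_zero_right mult_zero_left diff_0_right)
  next
    case True
    define q where "q = n - r"
    have q: "n = q + r" "r \<le> q" using True by (auto simp: q_def)
    define y where "y = (2 * x) ^ (n - 2 * r)"
    have b: "real (Suc r) * real (q choose Suc r) = (real q - real r) * real (q choose r)"
    proof -
      have "Suc r * (q choose Suc r) = (q - r) * (q choose r)"
        by (simp only: binomial_absorption binomial_absorb_comp)
      hence "real (Suc r * (q choose Suc r)) = real ((q - r) * (q choose r))" by (rule arg_cong)
      thus ?thesis using q(2) by (simp only: of_nat_mult of_nat_diff)
    qed
    have T2: "T (n + 2) (Suc r) = (-1) ^ Suc r * (real (q choose r) + real (q choose Suc r)) * c (Suc q) * y"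
      using q by (simp add: T_def y_def Suc_diff_le)
    have T1: "2 * x * T (n + 1) (Suc r) = (-1) ^ Suc r * real (q choose Suc r) * c q * y"
    \<comment> \<open>For q = r the exponent n + 1 - 2 * Suc r is truncated to 0 and does not match,
      but then q choose Suc r vanishes on both sides.\<close>
    proof (cases "q = r")
      case False
      hence "n - 2 * r = Suc (n + 1 - 2 * Suc r)" using q by simp
      thus ?thesis using q by (simp add: T_def y_def)
    qed (use q in \<open>simp add: T_def\<close>)
    have T: "T n r = (-1) ^ r * real (q choose r) * c q * y" by (simp add: T_def y_def q_def)
    define A B where "A = real (q choose r)" and "B = real (q choose Suc r)"
    have key: "(real q + real r + 2) * (A + B) * c (Suc q) =
       (lam + real q + real r + 1) * B * c q + (2 * lam + real q + real r) * A * c q"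
    proof -
      have B: "B = (real q - real r) * A / (real r + 1)"
        using b by (simp add: A_def B_def field_simps)
      have "c (Suc q) = (lam + real q) * c q / (real q + 1)" using c_Suc[of q] by (simp add: field_simps)
      note c' = this
      show ?thesis unfolding B c' by (simp add: divide_simps) (simp add: algebra_simps)
    qed
    have "(real n + 2) * T (n + 2) (Suc r) = (-1) ^ Suc r * y * ((real q + real r + 2) * (A + B) * c (Suc q))"
      unfolding T2 A_def B_def by (simp add: q(1))
    also have "\<dots> = (lam + real n + 1) * (2 * x * T (n + 1) (Suc r)) - (2 * lam + real n) * T n r"
      unfolding key T1 T A_def[symmetric] B_def[symmetric] by (simp add: q(1) algebra_simps)
    finally show ?thesis by simp
  qed
  have "(real n + 2) * gegenbauer lam (n + 2) x = (\<Sum>r\<le>Suc (n + 1). (real n + 2) * T (n + 2) r)"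
  proof -
    have e: "gegenbauer lam (n + 2) x = (\<Sum>r\<le>Suc (n + 1). T (n + 2) r)" by (rule ext) simp
    show ?thesis unfolding e by (rule sum_distrib_left)
  qed
  also have "\<dots> = 2 * (lam + real n + 1) * x * T (n + 1) 0
      + (\<Sum>r\<le>n + 1. 2 * (lam + real n + 1) * x * T (n + 1) (Suc r) - (2 * lam + real n) * T n r)"
    by (subst sum.atMost_Suc_shift) (simp only: T0 TSuc)
  also have "\<dots> = 2 * (lam + real n + 1) * x * (\<Sum>r\<le>Suc (n + 1). T (n + 1) r) - (2 * lam + real n) * (\<Sum>r\<le>n + 1. T n r)"
    unfolding sum.atMost_Suc_shift[of "T (n + 1)"]
    by (simp only: sum_subtractf sum_distrib_left distrib_left add_diff_eq)
  also have "\<dots> = 2 * (lam + real n + 1) * x * gegenbauer lam (n + 1) x - (2 * lam + real n) * gegenbauer lam n x"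
    by (simp only: ext[of "n + 1" "Suc (n + 1)"] ext[of n "n + 1"] le_add1 le_SucI order.refl)
  finally show ?thesis .
qed

lemma gegenbauer_0 [simp]: "gegenbauer lam 0 x = 1"
  by (simp add: gegenbauer_def)

lemma gegenbauer_1 [simp]: "gegenbauer lam (Suc 0) x = 2 * lam * x"
  by (simp add: gegenbauer_def)

text \<open>Closed form of the transform. Using \<open>rGamma\<close> for the denominator makes that
  factor entire, so the only points where the formula needs care are the poles of Gamma((s +
  eps)/2).\<close>

definition gegenbauer_mellin_form :: "real \<Rightarrow> nat \<Rightarrow> complex \<Rightarrow> complex" where
  "gegenbauer_mellin_form lam n s = Gamma (of_real (lam/2 + 1/4)) * Gamma ((s + of_bool (odd n)) / 2)
     * rGamma ((s + of_nat n + of_real lam) / 2 + 1/4)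
     * (pochhammer (2 * of_real lam) n / (2 * fact n)) * gegenbauer_red (of_real lam) n s"

lemma two_lam_nonzero:
  assumes "lam > -1/2"
  shows "2 * of_real lam + of_nat k + 1 \<noteq> (0 :: complex)"
proof -
  have "2 * of_real lam + of_nat k + 1 = complex_of_real (2 * lam + real k + 1)" by simp
  thus ?thesis using assms by (simp only: of_real_eq_0_iff)
qed

lemma gegenbauer_mellin_form_0:
  "gegenbauer_mellin_form lam 0 s = Gamma (of_real (lam/2 + 1/4)) * Gamma (s/2)
            / (2 * Gamma ((s + of_real lam) / 2 + 1/4))"
  by (simp add: gegenbauer_mellin_form_def rGamma_inverse_Gamma field_simps)

lemma gegenbauer_mellin_form_1: "gegenbauer_mellin_form lam 1 s = 2 * of_real lam * gegenbauer_mellin_form lam 0 (s + 1)"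
  by (simp add: gegenbauer_mellin_form_def add_ac)

text \<open>The recurrence of \<open>gegenbauer_red\<close> multiplied by the Gamma factors:
  Gamma(z+1) = z Gamma(z) yields its parity factor, and the functional equation of
  \<open>rGamma\<close> yields its factor (s+n+l+1/2)/2.\<close>

lemma gegenbauer_mellin_form_rec:
  assumes lam: "lam > -1/2" and s: "(s + of_bool (odd n)) / 2 \<notin> \<int>\<^sub>\<le>\<^sub>0"
  shows "(of_nat n + 2) * gegenbauer_mellin_form lam (n + 2) s =
     2 * (of_real lam + of_nat n + 1) * gegenbauer_mellin_form lam (n + 1) (s + 1)
     - (2 * of_real lam + of_nat n) * gegenbauer_mellin_form lam n s"
proof -
  define l m where "l = complex_of_real lam" and "m = (of_nat n :: complex)"
  define g where "g = Gamma (of_real (lam/2 + 1/4)) * Gamma ((s + of_bool (odd n)) / 2)"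
  define W where "W = rGamma ((s + m + l) / 2 + 1/4 + 1)"
  define P where "P = pochhammer (2 * l) n"
  define F where "F = (fact n :: complex)"
  define \<sigma> where "\<sigma> = (if even n then s else 2)"
  have nz: "m + 1 \<noteq> 0" "m + 2 \<noteq> 0" "F \<noteq> 0"
    using of_nat_neq_0[of n, where 'a = complex] of_nat_neq_0[of "n + 1", where 'a = complex]
    by (simp_all add: m_def F_def add_ac)
  \<comment> \<open>Level n+2 at s and level n+1 at s+1 have the same reciprocal Gamma factor; level
    n at s has it with argument smaller by 1.\<close>
  have ar: "(s + (m + 2) + l) / 2 + 1/4 = (s + m + l) / 2 + 1/4 + 1"
    "(s + 1 + (m + 1) + l) / 2 + 1/4 = (s + m + l) / 2 + 1/4 + 1"
    by (simp_all add: field_simps)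
  have M2: "gegenbauer_mellin_form lam (n + 2) s =
      g * W * (P * (2 * l + m) * (2 * l + m + 1) / (2 * ((m + 2) * (m + 1) * F))) * gegenbauer_red l (n + 2) s"
    unfolding gegenbauer_mellin_form_def l_def[symmetric] g_def W_def P_def F_def
    using ar(1) by (simp add: m_def pochhammer_Suc add_ac del: gegenbauer_red.simps)
  \<comment> \<open>Origin of the parity factor: for odd n both Gamma arguments coincide, for even n
    they differ by 1.\<close>
  have Gam: "Gamma ((s + 1 + of_bool (odd (n + 1))) / 2) = \<sigma> / 2 * Gamma ((s + of_bool (odd n)) / 2)"
  proof (cases "even n")
    case True
    have "Gamma (s / 2 + 1) = s / 2 * Gamma (s / 2)"
      using s True by (intro Gamma_plus1) auto
    thus ?thesis using True by (simp add: \<sigma>_def add_divide_distrib add.commute)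
  qed (simp add: \<sigma>_def)
  have M1: "gegenbauer_mellin_form lam (n + 1) (s + 1) =
      \<sigma> / 2 * g * W * (P * (2 * l + m) / (2 * ((m + 1) * F))) * gegenbauer_red l (n + 1) (s + 1)"
    unfolding gegenbauer_mellin_form_def l_def[symmetric] g_def W_def P_def F_def Gam
    using ar(2) by (simp add: m_def pochhammer_Suc add_ac del: gegenbauer_red.simps)
  have "rGamma ((s + m + l) / 2 + 1/4) = ((s + m + l) / 2 + 1/4) * W"
    unfolding W_def by (rule rGamma_plus1[symmetric])
  hence M0: "gegenbauer_mellin_form lam n s =
      g * (((s + m + l) / 2 + 1/4) * W) * (P / (2 * F)) * gegenbauer_red l n s"
    unfolding gegenbauer_mellin_form_def l_def[symmetric] m_def[symmetric] g_def P_def F_def by simp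
  define C where "C = g * W * P * (2 * l + m) / (2 * (m + 1) * F)"
  have "(m + 2) * gegenbauer_mellin_form lam (n + 2) s = C * ((2 * l + m + 1) * gegenbauer_red l (n + 2) s)"
  proof -
    have "L * (a * (b * d * e / (2 * (L * K * H))) * R) = a * b * d / (2 * K * H) * (e * R)" if "L \<noteq> 0"
      for L K H R a b d e :: complex using that by (simp add: mult.assoc)
    from this[OF nz(2), of "g * W" P "2 * l + m" "2 * l + m + 1" "m + 1" F "gegenbauer_red l (n + 2) s"]
    show ?thesis unfolding M2 C_def by (simp only: mult.assoc)
  qed
  also have "(2 * l + m + 1) * gegenbauer_red l (n + 2) s =
       (l + m + 1) * \<sigma> * gegenbauer_red l (n + 1) (s + 1) - (m + 1) * ((s + m + l + 1/2) / 2) * gegenbauer_red l n s"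
    unfolding l_def m_def \<sigma>_def by (rule gegenbauer_red_rec_plus[OF two_lam_nonzero[OF lam]])
  also have "C * \<dots> = C * (l + m + 1) * \<sigma> * gegenbauer_red l (n + 1) (s + 1)
      - C * (m + 1) * ((s + m + l + 1/2) / 2) * gegenbauer_red l n s"
    by (simp add: right_diff_distrib mult.assoc)
  also have "C * (l + m + 1) * \<sigma> * gegenbauer_red l (n + 1) (s + 1) = 2 * (l + m + 1) * gegenbauer_mellin_form lam (n + 1) (s + 1)"
  proof -
    have "a / (2 * K * H) * L * \<sigma> * R = 2 * L * (\<sigma> / 2 * b * (d / (2 * (K * H))) * R)" if "a = b * d"
      for a b d K H L R :: complex using that by (simp add: mult_ac)
    from this[of "g * W * P * (2 * l + m)" "g * W" "P * (2 * l + m)" "m + 1" F "l + m + 1"]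
    show ?thesis unfolding M1 C_def by (simp only: mult.assoc)
  qed
  also have "C * (m + 1) * ((s + m + l + 1/2) / 2) * gegenbauer_red l n s = (2 * l + m) * gegenbauer_mellin_form lam n s"
  proof -
    have h: "(s + m + l + 1/2) / 2 = (s + m + l) / 2 + 1/4" by (simp add: field_simps)
    have "C * (m + 1) = g * W * P * (2 * l + m) / (2 * F)"
    proof -
      have "X / (2 * K * H) * K = X / (2 * H)" if "K \<noteq> 0" for X K H :: complex using that by simp
      from this[OF nz(1)] show ?thesis unfolding C_def .
    qed
    thus ?thesis unfolding M0 h by (simp add: mult_ac)
  qed
  finally show ?thesis by (simp add: l_def m_def)
qed

lemma half_plane_not_nonpos_Int:
  assumes "Re s > - of_bool (odd n)"
  shows "(s + of_bool (odd n)) / 2 \<notin> \<int>\<^sub>\<le>\<^sub>0"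
proof
  assume "(s + of_bool (odd n)) / 2 \<in> \<int>\<^sub>\<le>\<^sub>0"
  then obtain k where "(s + of_bool (odd n)) / 2 = of_int k" "k \<le> 0" by (elim nonpos_Ints_cases)
  hence "Re ((s + of_bool (odd n)) / 2) \<le> 0" by simp
  thus False using assms by (cases "even n") simp_all
qed

lemma powr_mult_self: "x > 0 \<Longrightarrow> of_real x * complex_of_real x powr (s - 1) = of_real x powr s"
  by (simp add: powr_diff)

lemma gegenbauer_mellin_integral_0:
  assumes lam: "lam > -1/2" and s: "Re s > - of_bool (odd 0)"
  shows "set_integrable lborel {0<..<1} (gegenbauer_mellin_integrand lam 0 s) \<and>
      (LINT x:{0<..<1}|lborel. gegenbauer_mellin_integrand lam 0 s x) = gegenbauer_mellin_form lam 0 s"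
proof -
  define a where "a = lam / 2 + 1/4"
  have a: "a > 0" using lam by (simp add: a_def)
  have "gegenbauer_mellin_integrand lam 0 s x =
      of_real x powr (s - 1) * complex_of_real ((1 - x\<^sup>2) powr (a - 1))" for x
  proof -
    have "(1 - x\<^sup>2) powr (a - 1) = (1 - x\<^sup>2) powr (- (3/4 - lam/2))"
      by (rule arg_cong[of _ _ "\<lambda>e. (1 - x\<^sup>2) powr e"]) (simp add: a_def)
    thus ?thesis by (simp only: gegenbauer_mellin_integrand_def powr_minus divide_inverse of_real_inverse) simp
  qed
  hence eq: "gegenbauer_mellin_integrand lam 0 s =
      (\<lambda>x. of_real x powr (s - 1) * complex_of_real ((1 - x\<^sup>2) powr (a - 1)))" by auto
  have "(s + of_real lam) / 2 + 1/4 = s / 2 + of_real a"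
    by (simp add: a_def field_simps)
  moreover have "Re s > 0" using s by simp
  ultimately show ?thesis using beta_integral_square[OF _ a, of s] unfolding eq
    by (simp add: gegenbauer_mellin_form_def a_def add_divide_distrib add.assoc)
qed

text \<open>Induction along the three-term recurrence, in which the factor x raises s to s+1.
  Integrability is carried along because splitting the integral of a difference requires it.\<close>

lemma gegenbauer_mellin_integral:
  assumes lam: "lam > -1/2"
  shows "Re s > - of_bool (odd n) \<Longrightarrow>
      set_integrable lborel {0<..<1} (gegenbauer_mellin_integrand lam n s) \<and>
      (LINT x:{0<..<1}|lborel. gegenbauer_mellin_integrand lam n s x) = gegenbauer_mellin_form lam n s"
proof (induction n arbitrary: s rule: induct_nat_012)
  case 0
  thus ?case by (rule gegenbauer_mellin_integral_0[OF lam])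
next
  case 1
  hence s: "Re (s + 1) > - of_bool (odd 0)" by simp
  have eq: "gegenbauer_mellin_integrand lam 1 s x =
      2 * of_real lam * gegenbauer_mellin_integrand lam 0 (s + 1) x" if "x \<in> {0<..<1}" for x
    using that by (simp add: gegenbauer_mellin_integrand_def powr_mult_self)
  note I0 = gegenbauer_mellin_integral_0[OF lam s]
  have "set_integrable lborel {0<..<1} (gegenbauer_mellin_integrand lam 1 s) \<longleftrightarrow>
      set_integrable lborel {0<..<1} (\<lambda>x. 2 * of_real lam * gegenbauer_mellin_integrand lam 0 (s + 1) x)"
    by (rule set_integrable_cong[OF refl refl eq])
  moreover have "set_integrable lborel {0<..<1} (\<lambda>x. 2 * of_real lam * gegenbauer_mellin_integrand lam 0 (s + 1) x)"
    by (rule set_integrable_mult_right) (use I0 in blast)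
  moreover have "(LINT x:{0<..<1}|lborel. gegenbauer_mellin_integrand lam 1 s x) =
      (LINT x:{0<..<1}|lborel. 2 * of_real lam * gegenbauer_mellin_integrand lam 0 (s + 1) x)"
    by (intro set_lebesgue_integral_cong allI impI eq) simp_all
  moreover have "\<dots> = gegenbauer_mellin_form lam 1 s"
    unfolding gegenbauer_mellin_form_1 set_integral_mult_right using I0 by simp
  ultimately show ?case by (simp only: One_nat_def)
next
  case (ge2 n)
  define A B where "A = 2 * (complex_of_real lam + of_nat n + 1)" and "B = 2 * complex_of_real lam + of_nat n"
  let ?I = "gegenbauer_mellin_integrand lam"
  have n2: "of_nat n + 2 \<noteq> (0 :: complex)"
    using of_nat_neq_0[of "n + 1", where 'a = complex] by (simp add: add_ac)
  \<comment> \<open>Passing to s+1 while the parity flips never leaves the half-plane: for odd n the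
    bound -1 becomes exactly 0, for even n there is room to spare.\<close>
  have s: "Re s > - of_bool (odd n)" "Re (s + 1) > - of_bool (odd (Suc n))"
    using ge2.prems by (auto simp: of_bool_def split: if_splits)
  note I0 = ge2.IH(1)[OF s(1)] and I1 = ge2.IH(2)[OF s(2)]
  have eq: "?I (Suc (Suc n)) s x = (A * ?I (Suc n) (s + 1) x - B * ?I n s x) / (of_nat n + 2)"
    if "x \<in> {0<..<1}" for x
  proof -
    have "complex_of_real ((real n + 2) * gegenbauer lam (n + 2) x) =
        of_real (2 * (lam + real n + 1) * x * gegenbauer lam (n + 1) x - (2 * lam + real n) * gegenbauer lam n x)"
      by (rule arg_cong[OF gegenbauer_recurrence])
    hence "(of_nat n + 2) * complex_of_real (gegenbauer lam (Suc (Suc n)) x) =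
        A * of_real x * of_real (gegenbauer lam (Suc n) x) - B * of_real (gegenbauer lam n x)"
      by (simp add: A_def B_def)
    hence C: "complex_of_real (gegenbauer lam (Suc (Suc n)) x) =
        (A * of_real x * of_real (gegenbauer lam (Suc n) x) - B * of_real (gegenbauer lam n x)) / (of_nat n + 2)"
      by (intro eq_divide_imp[OF n2]) (simp only: mult.commute)
    have p: "complex_of_real x powr (s + 1 - 1) = of_real x * of_real x powr (s - 1)"
      using that powr_mult_self[of x s] by simp
    show ?thesis unfolding gegenbauer_mellin_integrand_def C p
      by (simp add: diff_divide_distrib left_diff_distrib right_diff_distrib mult_ac)
  qed
  have "set_integrable lborel {0<..<1} (?I (Suc (Suc n)) s)"
  proof -
    have "set_integrable lborel {0<..<1} (\<lambda>x. (A * ?I (Suc n) (s + 1) x - B * ?I n s x) / (of_nat n + 2))"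
      by (intro set_integrable_divide set_integral_diff set_integrable_mult_right) (use I0 I1 in blast)+
    moreover have "set_integrable lborel {0<..<1} (?I (Suc (Suc n)) s) \<longleftrightarrow>
        set_integrable lborel {0<..<1} (\<lambda>x. (A * ?I (Suc n) (s + 1) x - B * ?I n s x) / (of_nat n + 2))"
      by (rule set_integrable_cong[OF refl refl eq])
    ultimately show ?thesis by simp
  qed
  moreover have "(LINT x:{0<..<1}|lborel. ?I (Suc (Suc n)) s x) = gegenbauer_mellin_form lam (Suc (Suc n)) s"
  proof -
    have "(LINT x:{0<..<1}|lborel. ?I (Suc (Suc n)) s x) =
        (LINT x:{0<..<1}|lborel. (A * ?I (Suc n) (s + 1) x - B * ?I n s x) / (of_nat n + 2))"
      by (intro set_lebesgue_integral_cong allI impI eq) simp_all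
    also have "\<dots> = (A * gegenbauer_mellin_form lam (Suc n) (s + 1) - B * gegenbauer_mellin_form lam n s) / (of_nat n + 2)"
    proof -
      have "set_integrable lborel {0<..<1} (\<lambda>x. A * ?I (Suc n) (s + 1) x)"
        "set_integrable lborel {0<..<1} (\<lambda>x. B * ?I n s x)"
        by (intro set_integrable_mult_right; use I0 I1 in blast)+
      from set_integral_diff(2)[OF this] show ?thesis
        using I0 I1 by (simp only: set_integral_divide_zero set_integral_mult_right)
    qed
    also have "\<dots> = gegenbauer_mellin_form lam (Suc (Suc n)) s"
    proof -
      from gegenbauer_mellin_form_rec[OF lam half_plane_not_nonpos_Int[OF s(1)]]
      have "(of_nat n + 2) * gegenbauer_mellin_form lam (Suc (Suc n)) s =
          A * gegenbauer_mellin_form lam (Suc n) (s + 1) - B * gegenbauer_mellin_form lam n s"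
        by (simp add: A_def B_def)
      thus ?thesis by (intro eq_divide_imp[OF n2, symmetric]) (simp only: mult.commute)
    qed
    finally show ?thesis .
  qed
  ultimately show ?case by simp
qed

section \<open>Analytic continuation\<close>

text \<open>By the identity theorem the difference, with its singularities removed, is 0. Hence both
  functions agree in a punctured neighbourhood of every point and share poles and limits there;
  niceness fixes the value itself, as the limit or as 0 at a pole. This gives the uniqueness needed
  to evaluate the definite description in \<open>gegenbauer_mellin\<close>.\<close>

lemma nicely_meromorphic_eqI:
  assumes f: "f nicely_meromorphic_on UNIV" and g: "g nicely_meromorphic_on UNIV"
    and eq: "frequently (\<lambda>z. f z = g z) (at z0)"
  shows "f = g"
proof
  fix z
  have "(\<lambda>z. f z - g z) meromorphic_on UNIV"
    using f g by (auto simp: nicely_meromorphic_on_def intro!: meromorphic_intros)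
  hence iso: "isolated_singularity_at (\<lambda>z. f z - g z) w" for w
    by (meson UNIV_I meromorphic_on_isolated_singularity meromorphic_on_meromorphic_at
        meromorphic_on_subset subset_UNIV)
  have nice: "remove_sings (\<lambda>z. f z - g z) nicely_meromorphic_on UNIV"
    by (rule remove_sings_nicely_meromorphic) fact
  have "frequently (\<lambda>w. remove_sings (\<lambda>z. f z - g z) w = 0) (at z0)"
    by (rule frequently_rev_mp[OF eq], rule eventually_mono[OF eventually_remove_sings_eq_at[OF iso]]) auto
  from frequently_eq_meromorphic_imp_constant[OF this nice]
  have "remove_sings (\<lambda>z. f z - g z) w = 0" for w by (simp add: connected_UNIV)
  with eventually_remove_sings_eq_at[OF iso, of z]
  have ev: "eventually (\<lambda>w. f w = g w) (at z)" by (auto elim: eventually_mono)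
  have pole: "is_pole f z \<longleftrightarrow> is_pole g z" by (rule is_pole_cong[OF ev refl])
  have lim: "(f \<midarrow>z\<rightarrow> c) \<longleftrightarrow> (g \<midarrow>z\<rightarrow> c)" for c by (rule tendsto_cong[OF ev])
  have "is_pole f z \<and> f z = 0 \<or> f \<midarrow>z\<rightarrow> f z" "is_pole g z \<and> g z = 0 \<or> g \<midarrow>z\<rightarrow> g z"
    using f g by (auto simp: nicely_meromorphic_on_def)
  moreover have False if "is_pole h z" "h \<midarrow>z\<rightarrow> c" for h :: "complex \<Rightarrow> complex" and c
    using that not_tendsto_and_filterlim_at_infinity[OF at_neq_bot, of h c z] by (simp add: is_pole_def)
  ultimately show "f z = g z"
    using pole lim LIM_unique[of f "f z" z "g z"] by metis
qed

text \<open>Two points w with (w + c)/2 an integer differ by a multiple of 2, whereas two points of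
  a ball of radius 1 are less than 2 apart. The ball therefore contains at most one of them.\<close>

lemma eventually_at_not_nonpos_Int:
  fixes z c :: complex
  shows "eventually (\<lambda>w. (w + c) / 2 \<notin> \<int>\<^sub>\<le>\<^sub>0) (at z)"
proof -
  have ball: "eventually (\<lambda>w. w \<in> ball z 1) (at z)" by (rule eventually_at_in_open') auto
  show ?thesis
  proof (cases "\<exists>w0\<in>ball z 1. (w0 + c) / 2 \<in> \<int>")
    case False
    with ball show ?thesis by (auto elim!: eventually_mono dest: subsetD[OF nonpos_Ints_subset_Ints])
  next
    case True
    then obtain w0 where w0: "w0 \<in> ball z 1" "(w0 + c) / 2 \<in> \<int>" by blast
    have "eventually (\<lambda>w. w \<noteq> w0) (at z)" by (rule eventually_neq_at_within)
    with ball show ?thesis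
    proof eventually_elim
      case (elim w)
      show ?case
      proof
        assume "(w + c) / 2 \<in> \<int>\<^sub>\<le>\<^sub>0"
        hence "(w + c) / 2 \<in> \<int>" using nonpos_Ints_subset_Ints by blast
        hence "(w + c) / 2 - (w0 + c) / 2 \<in> \<int>" using w0(2) by (rule Ints_diff)
        then obtain k where k: "(w + c) / 2 - (w0 + c) / 2 = of_int k" by (elim Ints_cases)
        have "w - w0 = 2 * of_int k"
        proof -
          have "(w - w0) / 2 = of_int k" using k by (simp add: diff_divide_distrib add_divide_distrib)
          thus ?thesis by (simp add: divide_eq_eq mult.commute)
        qed
        hence "norm (w - w0) = 2 * \<bar>of_int k\<bar>" by (simp add: norm_mult)
        moreover have "norm (w - w0) < 2"
          using w0(1) elim(1) dist_triangle2[of w w0 z]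
          by (simp add: dist_norm norm_minus_commute)
        ultimately have "k = 0" by linarith
        thus False using \<open>w - w0 = 2 * of_int k\<close> elim(2) by simp
      qed
    qed
  qed
qed

lemma gegenbauer_mellin_form_analytic:
  assumes "(s + of_bool (odd n)) / 2 \<notin> \<int>\<^sub>\<le>\<^sub>0"
  shows "gegenbauer_mellin_form lam n analytic_on {s}"
  unfolding gegenbauer_mellin_form_def[abs_def] using assms
  by (intro analytic_intros gegenbauer_red_analytic) auto

lemma gegenbauer_mellin_form_meromorphic: "gegenbauer_mellin_form lam n meromorphic_on UNIV"
proof -
  have "(\<lambda>s. rGamma ((s + of_bool (odd n)) / 2)) analytic_on UNIV"
    by (intro analytic_intros) auto
  hence "(\<lambda>s. inverse (rGamma ((s + of_bool (odd n)) / 2))) meromorphic_on UNIV"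
    by (intro meromorphic_on_inverse analytic_on_imp_meromorphic_on)
  hence G: "(\<lambda>s. Gamma ((s + of_bool (odd n)) / 2)) meromorphic_on UNIV"
    by (simp add: rGamma_inverse_Gamma)
  have R: "(\<lambda>s. rGamma ((s + of_nat n + of_real lam) / 2 + 1/4)) meromorphic_on UNIV"
    by (intro analytic_on_imp_meromorphic_on analytic_intros) auto
  show ?thesis unfolding gegenbauer_mellin_form_def[abs_def]
    by (intro meromorphic_on_mult meromorphic_on_const G R
        analytic_on_imp_meromorphic_on[OF gegenbauer_red_analytic])
qed

text \<open>\<open>remove_sings\<close> changes nothing where the closed form is analytic, in
  particular nothing in the half-plane of the integral, while turning it into a nicely meromorphic
  function.\<close>

lemma gegenbauer_mellin_eq_remove_sings:
  assumes lam: "lam > -1/2"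
  shows "gegenbauer_mellin lam n = remove_sings (gegenbauer_mellin_form lam n)"
proof -
  let ?F = "remove_sings (gegenbauer_mellin_form lam n)"
  have nice: "?F nicely_meromorphic_on UNIV"
    by (rule remove_sings_nicely_meromorphic[OF gegenbauer_mellin_form_meromorphic])
  have int: "?F s = (LINT x:{0<..<1}|lborel. gegenbauer_mellin_integrand lam n s x)"
    if "Re s > - of_bool (odd n)" for s
    using gegenbauer_mellin_integral[OF lam that] gegenbauer_mellin_form_analytic[OF half_plane_not_nonpos_Int[OF that]]
    by simp
  show ?thesis unfolding gegenbauer_mellin_def
  proof (rule the_equality, intro conjI allI impI)
    fix F assume F: "F nicely_meromorphic_on UNIV \<and>
        (\<forall>s. - of_bool (odd n) < Re s \<longrightarrow> F s = (LINT x:{0<..<1}|lborel. gegenbauer_mellin_integrand lam n s x))"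
    \<comment> \<open>The point 1 is interior to the half-plane of definition for both parities, so
      agreement there is enough for uniqueness.\<close>
    have "eventually (\<lambda>s. s \<in> {s. Re s > 0}) (at 1)"
      by (rule eventually_at_in_open') (auto simp: open_halfspace_Re_gt)
    hence "eventually (\<lambda>s. F s = ?F s) (at 1)"
    proof eventually_elim
      case (elim s)
      hence "- of_bool (odd n) < Re s" by (cases "even n") auto
      thus ?case using F int by simp
    qed
    thus "F = ?F" using F nice
      by (intro nicely_meromorphic_eqI[of _ _ 1] eventually_frequently) auto
  qed (use nice int in auto)
qed

lemma gegenbauer_mellin_eq_form:
  assumes "lam > -1/2" "(s + of_bool (odd n)) / 2 \<notin> \<int>\<^sub>\<le>\<^sub>0"
  shows "gegenbauer_mellin lam n s = gegenbauer_mellin_form lam n s"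
  using assms by (simp add: gegenbauer_mellin_eq_remove_sings gegenbauer_mellin_form_analytic)

text \<open>This carries identities proved at generic points over to the exceptional ones.\<close>

lemma gegenbauer_mellin_isCont:
  assumes "lam > -1/2" "\<not> is_pole (gegenbauer_mellin lam n) s"
  shows "isCont (gegenbauer_mellin lam n) s"
proof -
  have "gegenbauer_mellin lam n nicely_meromorphic_on UNIV"
    unfolding gegenbauer_mellin_eq_remove_sings[OF assms(1)]
    by (rule remove_sings_nicely_meromorphic[OF gegenbauer_mellin_form_meromorphic])
  thus ?thesis using assms(2) by (auto simp: nicely_meromorphic_on_def isCont_def)
qed

lemma gegenbauer_mellin_isCont_shift:
  assumes "lam > -1/2" "\<not> is_pole (gegenbauer_mellin lam n) (s + c)"
  shows "isCont (\<lambda>s. gegenbauer_mellin lam n (s + c)) s"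
  by (rule isCont_o2[of s "\<lambda>s. s + c" "gegenbauer_mellin lam n", OF _ gegenbauer_mellin_isCont[OF assms]]) (intro continuous_intros)

section \<open>Identities for the continued transforms and their factors\<close>

lemma isCont_eventually_zero:
  assumes "isCont f s" "eventually (\<lambda>w. f w = (0 :: complex)) (at (s :: complex))"
  shows "f s = 0"
proof (rule LIM_unique)
  show "f \<midarrow>s\<rightarrow> f s" using assms(1) by (simp add: isCont_def)
  show "f \<midarrow>s\<rightarrow> 0" by (rule tendsto_eventually) (rule assms(2))
qed

text \<open>The quotient under \<open>remove_sings\<close> equals the polynomial on a punctured
  neighbourhood of every point, so the removed value is the limit of the polynomial, that is, its
  value.\<close>

lemma gegenbauer_mellin_factor_eq:
  assumes lam: "lam > -1/2"
  shows "gegenbauer_mellin_factor lam n s = pochhammer (2 * of_real lam) n * gegenbauer_red (of_real lam) n s"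
  unfolding gegenbauer_mellin_factor_def
proof (rule remove_sings_eqI, rule Lim_transform_eventually)
  let ?p = "\<lambda>s. pochhammer (2 * of_real lam) n * gegenbauer_red (of_real lam) n s"
  have "isCont ?p s"
    by (intro isCont_mult continuous_const analytic_at_imp_isCont gegenbauer_red_analytic)
  thus "?p \<midarrow>s\<rightarrow> ?p s" by (simp add: isCont_def)
  have ar: "(w + (of_nat n + of_real lam + 1/2)) / 2 = (w + of_nat n + of_real lam) / 2 + 1/4" for w :: complex
    by (simp add: field_simps)
  have Ga: "Gamma (complex_of_real (lam/2 + 1/4)) \<noteq> 0"
  proof -
    have "Gamma (lam/2 + 1/4) > 0" using lam by (intro Gamma_real_pos) simp
    thus ?thesis unfolding Gamma_complex_of_real by simp
  qed
  \<comment> \<open>At a pole \<open>Gamma\<close> has the value 0 and the quotient is meaningless;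
    outside these poles both factors are nonzero and cancel.\<close>
  have "eventually (\<lambda>w. (w + (of_nat n + of_real lam + 1/2)) / 2 \<notin> \<int>\<^sub>\<le>\<^sub>0 \<and> (w + of_bool (odd n)) / 2 \<notin> \<int>\<^sub>\<le>\<^sub>0) (at s)"
    by (intro eventually_conj eventually_at_not_nonpos_Int)
  thus "eventually (\<lambda>w. ?p w = gegenbauer_mellin lam n w
       * (2 * fact n * Gamma ((w + of_nat n + of_real lam) / 2 + 1/4))
       / (Gamma (of_real (lam/2 + 1/4)) * Gamma ((w + of_bool (odd n)) / 2))) (at s)"
  proof eventually_elim
    case (elim w)
    hence nz: "Gamma ((w + of_nat n + of_real lam) / 2 + 1/4) \<noteq> 0" "Gamma ((w + of_bool (odd n)) / 2) \<noteq> 0"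
      unfolding ar by (auto simp: Gamma_eq_zero_iff)
    have aux: "P * R = A * B * inverse C * (P / (2 * D)) * R * (2 * D * C) / (A * B)"
      if "A \<noteq> 0" "B \<noteq> 0" "C \<noteq> 0" "D \<noteq> 0" for A B C D P R :: complex
      using that by (simp add: field_simps)
    show ?case
      unfolding gegenbauer_mellin_eq_form[OF lam conjunct2[OF elim]] gegenbauer_mellin_form_def rGamma_inverse_Gamma
      by (rule aux) (use nz Ga in simp_all)
  qed
qed

text \<open>The defect \<open>f\<close> of the identity is continuous at s since none of the three
  transforms has a pole, and it vanishes at all nearby points where the closed forms hold. The
  difference equation in s is continued in the same way.\<close>

lemma gegenbauer_mellin_rec:
  assumes lam: "lam > -1/2"
    and np: "\<not> is_pole (gegenbauer_mellin lam (n + 2)) s"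
      "\<not> is_pole (gegenbauer_mellin lam (n + 1)) (s + 1)" "\<not> is_pole (gegenbauer_mellin lam n) s"
  shows "(of_nat n + 2) * gegenbauer_mellin lam (n + 2) s =
          2 * (of_real lam + of_nat n + 1) * gegenbauer_mellin lam (n + 1) (s + 1)
          - (2 * of_real lam + of_nat n) * gegenbauer_mellin lam n s"
proof -
  let ?M = "gegenbauer_mellin lam"
  define f where "f w = (of_nat n + 2) * ?M (n + 2) w -
      (2 * (of_real lam + of_nat n + 1) * ?M (n + 1) (w + 1) - (2 * of_real lam + of_nat n) * ?M n w)" for w
  have "isCont f s" unfolding f_def
    by (intro isCont_diff isCont_mult continuous_const gegenbauer_mellin_isCont gegenbauer_mellin_isCont_shift lam np)
  moreover have "eventually (\<lambda>w. f w = 0) (at s)"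
  proof -
    have "eventually (\<lambda>w. (w + of_bool (odd n)) / 2 \<notin> \<int>\<^sub>\<le>\<^sub>0 \<and> (w + (1 + of_bool (odd (n + 1)))) / 2 \<notin> \<int>\<^sub>\<le>\<^sub>0) (at s)"
      by (intro eventually_conj eventually_at_not_nonpos_Int)
    thus ?thesis
    proof eventually_elim
      case (elim w)
      have "?M (n + 2) w = gegenbauer_mellin_form lam (n + 2) w" "?M n w = gegenbauer_mellin_form lam n w"
        "?M (n + 1) (w + 1) = gegenbauer_mellin_form lam (n + 1) (w + 1)"
        using elim by (intro gegenbauer_mellin_eq_form[OF lam]; simp add: add.assoc)+
      thus ?case unfolding f_def using gegenbauer_mellin_form_rec[OF lam, of w n] elim by simp
    qed
  qed
  ultimately have "f s = 0" by (rule isCont_eventually_zero)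
  thus ?thesis by (simp add: f_def)
qed

text \<open>Nothing is assumed about M_0 at s+1. Dividing by 2 lam, which is nonzero, shows that M_0
  has a finite limit there, so s+1 is not a pole and the value is that limit.\<close>

lemma gegenbauer_mellin_1:
  assumes lam: "lam > -1/2" "lam \<noteq> 0" and np: "\<not> is_pole (gegenbauer_mellin lam 1) s"
  shows "gegenbauer_mellin lam 1 s = 2 * of_real lam * gegenbauer_mellin lam 0 (s + 1)"
proof -
  let ?M = "gegenbauer_mellin lam"
  have "eventually (\<lambda>w. (w + of_bool (odd (1 :: nat))) / 2 \<notin> \<int>\<^sub>\<le>\<^sub>0) (at s)"
    by (rule eventually_at_not_nonpos_Int)
  hence ev: "eventually (\<lambda>w. ?M 1 w = 2 * of_real lam * ?M 0 (w + 1)) (at s)"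
  proof eventually_elim
    case (elim w)
    have "?M 1 w = gegenbauer_mellin_form lam 1 w" "?M 0 (w + 1) = gegenbauer_mellin_form lam 0 (w + 1)"
      using elim by (intro gegenbauer_mellin_eq_form[OF lam(1)]; simp)+
    thus ?case by (simp only: gegenbauer_mellin_form_1)
  qed
  have "?M 1 \<midarrow>s\<rightarrow> ?M 1 s"
    using gegenbauer_mellin_isCont[OF lam(1) np] by (simp add: isCont_def)
  hence "(\<lambda>w. 2 * of_real lam * ?M 0 (w + 1)) \<midarrow>s\<rightarrow> ?M 1 s"
    using tendsto_cong[OF ev] by simp
  hence "(\<lambda>w. 2 * of_real lam * ?M 0 (w + 1) / (2 * of_real lam)) \<midarrow>s\<rightarrow> ?M 1 s / (2 * of_real lam)"
    by (rule tendsto_divide) (use lam in auto)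
  hence "(?M 0 \<circ> (+) 1) \<midarrow>s\<rightarrow> ?M 1 s / (2 * of_real lam)"
    using lam by (simp add: o_def add.commute)
  hence lim: "?M 0 \<midarrow>(s + 1)\<rightarrow> ?M 1 s / (2 * of_real lam)"
    using filterlim_shift_iff[of "?M 0" 1 "nhds (?M 1 s / (2 * of_real lam))" "s + 1"] by simp
  have "\<not> is_pole (?M 0) (s + 1)"
    using not_tendsto_and_filterlim_at_infinity[OF at_neq_bot lim] by (auto simp: is_pole_def)
  hence "?M 0 \<midarrow>(s + 1)\<rightarrow> ?M 0 (s + 1)"
    using gegenbauer_mellin_isCont[OF lam(1)] by (simp add: isCont_def)
  hence "?M 0 (s + 1) = ?M 1 s / (2 * of_real lam)" using lim by (rule LIM_unique)
  thus ?thesis using lam by simp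
qed

text \<open>The difference equation of \<open>gegenbauer_red\<close> multiplied by the Gamma
  factors, all referred to \<open>z\<close>, the Gamma argument at s-2, and to \<open>w\<close>. The
  factor (s-1)(s-2) contains 2z in either parity: s-2 = 2z for even n and s-1 = 2z for odd
  n.\<close>

lemma gegenbauer_mellin_form_difference_eq:
  assumes lam: "lam > -1/2"
    and z: "(s - 2 + of_bool (odd n)) / 2 \<notin> \<int>\<^sub>\<le>\<^sub>0" "(s + of_bool (odd n)) / 2 \<notin> \<int>\<^sub>\<le>\<^sub>0"
  shows "(6 - 4 * (of_real lam + 2 * of_real lam * of_nat n + (of_nat n)\<^sup>2)
           - 16 * s + 8 * s * (s + 1)) * gegenbauer_mellin_form lam n s
        + (- 9 + 4 * (of_nat n + of_real lam)\<^sup>2 + 16 * (s + 2) - 4 * (s + 2) * (s + 3))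
           * gegenbauer_mellin_form lam n (s + 2)
        - 4 * (s - 1) * (s - 2) * gegenbauer_mellin_form lam n (s - 2) = 0"
proof -
  define l m \<epsilon> where "l = complex_of_real lam" and "m = (of_nat n :: complex)"
    and "\<epsilon> = (of_bool (odd n) :: complex)"
  define z where "z = (s + \<epsilon>) / 2 - 1"
  define w where "w = (s + m + l) / 2 + 1/4"
  define R where "R = gegenbauer_red l n"
  define u v where "u = s + m + l - 3/2" and "v = m + l - 1/2 - s"
  \<comment> \<open>The factor w is included so that the values at s and s-2 are multiples of
    \<open>C\<close>. For s+2 only w times the value is one; as w may vanish, it is not divided out,
    and the missing w comes from the coefficient of that term.\<close>
  define C where "C = Gamma (of_real (lam/2 + 1/4)) * (pochhammer (2 * l) n / (2 * fact n))
      * Gamma z * rGamma (w + 1) * w"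
  define A where "A = 6 - 4 * (l + 2 * l * m + m\<^sup>2) - 16 * s + 8 * s * (s + 1)"
  have z1: "Gamma (z + 1) = z * Gamma z"
  proof (rule Gamma_plus1)
    have "z = (s - 2 + of_bool (odd n)) / 2"
      unfolding z_def \<epsilon>_def[symmetric] by (simp add: field_simps)
    thus "z \<notin> \<int>\<^sub>\<le>\<^sub>0" using z(1) by (simp only: not_False_eq_True)
  qed
  have z2: "Gamma (z + 2) = (z + 1) * z * Gamma z"
  proof -
    have "Gamma (z + 1 + 1) = (z + 1) * Gamma (z + 1)"
      using z(2) by (intro Gamma_plus1) (simp add: z_def \<epsilon>_def)
    thus ?thesis by (simp add: z1 add.assoc)
  qed
  have w1: "rGamma w = w * rGamma (w + 1)" by (rule rGamma_plus1[symmetric])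
  have w2: "rGamma (w - 1) = (w - 1) * w * rGamma (w + 1)"
    using rGamma_plus1[of "w - 1"] by (simp add: w1 mult.assoc)
  have ar: "(s + 2 + \<epsilon>) / 2 = z + 2" "(s + \<epsilon>) / 2 = z + 1" "(s - 2 + \<epsilon>) / 2 = z"
    "(s + 2 + m + l) / 2 + 1/4 = w + 1" "(s + m + l) / 2 + 1/4 = w" "(s - 2 + m + l) / 2 + 1/4 = w - 1"
    by (simp_all add: z_def w_def field_simps)
  have wM: "w * gegenbauer_mellin_form lam n (s + 2) = C * ((z + 1) * z) * R (s + 2)"
    unfolding gegenbauer_mellin_form_def l_def[symmetric] m_def[symmetric] \<epsilon>_def[symmetric] ar z2 C_def R_def
    by (simp only: mult_ac)
  have M0: "gegenbauer_mellin_form lam n s = C * z * R s"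
    unfolding gegenbauer_mellin_form_def l_def[symmetric] m_def[symmetric] \<epsilon>_def[symmetric] ar z1 w1 C_def R_def
    by (simp only: mult_ac)
  have M': "gegenbauer_mellin_form lam n (s - 2) = C * (w - 1) * R (s - 2)"
    unfolding gegenbauer_mellin_form_def l_def[symmetric] m_def[symmetric] \<epsilon>_def[symmetric] ar w2 C_def R_def
    by (simp only: mult_ac)
  \<comment> \<open>A difference of squares: the coefficient is 4 ((n + lam)^2 - (s +
    1/2)^2).\<close>
  have B: "- 9 + 4 * (m + l)\<^sup>2 + 16 * (s + 2) - 4 * (s + 2) * (s + 3) = 8 * v * w"
    by (simp add: v_def w_def field_simps power2_eq_square)
  have A: "A = - 4 * (m * (2 * l + m - 1) + s * v + (1 - s) * u)"
    by (simp add: A_def u_def v_def field_simps power2_eq_square)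
  have u: "u = 2 * (w - 1)" by (simp add: u_def w_def field_simps)
  have key: "A * z * R s + 8 * v * ((z + 1) * z) * R (s + 2) - 4 * (s - 1) * (s - 2) * (w - 1) * R (s - 2) = 0"
  proof (cases "even n")
    case True
    have D: "m * (2 * l + m - 1) * R s = s * v * (R (s + 2) - R s) - (1 - s) * u * (R s - R (s - 2))"
      using gegenbauer_red_difference_eq[OF two_lam_nonzero[OF lam], of n s] True
      by (simp add: l_def m_def u_def v_def R_def)
    have s: "s = 2 * z + 2" using True by (simp add: z_def \<epsilon>_def)
    have "A * R s + 4 * s * v * R (s + 2) - 4 * (s - 1) * u * R (s - 2) =
        4 * (s * v * (R (s + 2) - R s) - (1 - s) * u * (R s - R (s - 2)) - m * (2 * l + m - 1) * R s)"
      unfolding A by (simp add: algebra_simps)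
    hence 0: "z * (A * R s + 4 * s * v * R (s + 2) - 4 * (s - 1) * u * R (s - 2)) = 0" by (simp add: D)
    have "s - 2 = 2 * z" "s = 2 * (z + 1)" using s by simp_all
    hence "8 * v * ((z + 1) * z) = z * (4 * s * v)" "4 * (s - 1) * (s - 2) * (w - 1) = z * (4 * (s - 1) * u)"
      unfolding u by simp_all
    thus ?thesis using 0 by (simp only: right_diff_distrib distrib_left mult_ac)
  next
    case False
    have D: "m * (2 * l + m - 1) * R s = v * ((s + 1) * R (s + 2) - s * R s) + u * ((s - 1) * R s + (2 - s) * R (s - 2))"
      using gegenbauer_red_difference_eq[OF two_lam_nonzero[OF lam], of n s] False
      by (simp add: l_def m_def u_def v_def R_def)
    have s: "s = 2 * z + 1" using False by (simp add: z_def \<epsilon>_def field_simps)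
    have "A * R s + 4 * (s + 1) * v * R (s + 2) - 4 * (s - 2) * u * R (s - 2) =
        4 * (v * ((s + 1) * R (s + 2) - s * R s) + u * ((s - 1) * R s + (2 - s) * R (s - 2)) - m * (2 * l + m - 1) * R s)"
      unfolding A by (simp add: algebra_simps)
    hence 0: "z * (A * R s + 4 * (s + 1) * v * R (s + 2) - 4 * (s - 2) * u * R (s - 2)) = 0" by (simp add: D)
    have "s - 1 = 2 * z" "s + 1 = 2 * (z + 1)" using s by simp_all
    hence "8 * v * ((z + 1) * z) = z * (4 * (s + 1) * v)" "4 * (s - 1) * (s - 2) * (w - 1) = z * (4 * (s - 2) * u)"
      unfolding u by (simp_all add: algebra_simps)
    thus ?thesis using 0 by (simp only: right_diff_distrib distrib_left mult_ac)
  qed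
  have "A * gegenbauer_mellin_form lam n s + 8 * v * (w * gegenbauer_mellin_form lam n (s + 2))
      - 4 * (s - 1) * (s - 2) * gegenbauer_mellin_form lam n (s - 2)
      = C * (A * z * R s + 8 * v * ((z + 1) * z) * R (s + 2) - 4 * (s - 1) * (s - 2) * (w - 1) * R (s - 2))"
    unfolding wM M0 M' by (simp add: algebra_simps)
  also have "\<dots> = 0" unfolding key by simp
  finally show ?thesis
    unfolding l_def[symmetric] m_def[symmetric] B A_def by (simp only: mult.assoc)
qed

lemma gegenbauer_mellin_difference_eq:
  assumes lam: "lam > -1/2"
    and np: "\<not> is_pole (gegenbauer_mellin lam n) s" "\<not> is_pole (gegenbauer_mellin lam n) (s + 2)"
      "\<not> is_pole (gegenbauer_mellin lam n) (s - 2)"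
  shows "(6 - 4 * (of_real lam + 2 * of_real lam * of_nat n + (of_nat n)\<^sup>2)
           - 16 * s + 8 * s * (s + 1)) * gegenbauer_mellin lam n s
        + (- 9 + 4 * (of_nat n + of_real lam)\<^sup>2 + 16 * (s + 2) - 4 * (s + 2) * (s + 3))
           * gegenbauer_mellin lam n (s + 2)
        - 4 * (s - 1) * (s - 2) * gegenbauer_mellin lam n (s - 2) = 0"
proof -
  let ?M = "gegenbauer_mellin lam n"
  define f where "f s = (6 - 4 * (of_real lam + 2 * of_real lam * of_nat n + (of_nat n)\<^sup>2)
           - 16 * s + 8 * s * (s + 1)) * ?M s
        + (- 9 + 4 * (of_nat n + of_real lam)\<^sup>2 + 16 * (s + 2) - 4 * (s + 2) * (s + 3)) * ?M (s + 2)
        - 4 * (s - 1) * (s - 2) * ?M (s - 2)" for s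
  have "isCont (\<lambda>w. ?M (w + - 2)) s"
    by (rule gegenbauer_mellin_isCont_shift[OF lam]) (use np in simp)
  hence "isCont (\<lambda>w. ?M (w - 2)) s" by simp
  hence "isCont f s" unfolding f_def
    by (intro isCont_diff isCont_add isCont_mult continuous_const continuous_ident gegenbauer_mellin_isCont gegenbauer_mellin_isCont_shift lam np)
  moreover have "eventually (\<lambda>w. f w = 0) (at s)"
  proof -
    have "eventually (\<lambda>w. (w + (- 2 + of_bool (odd n))) / 2 \<notin> \<int>\<^sub>\<le>\<^sub>0 \<and> (w + of_bool (odd n)) / 2 \<notin> \<int>\<^sub>\<le>\<^sub>0
        \<and> (w + (2 + of_bool (odd n))) / 2 \<notin> \<int>\<^sub>\<le>\<^sub>0) (at s)"
      by (intro eventually_conj eventually_at_not_nonpos_Int)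
    thus ?thesis
    proof eventually_elim
      case (elim w)
      have e: "(w - 2 + of_bool (odd n)) / 2 \<notin> \<int>\<^sub>\<le>\<^sub>0" "(w + of_bool (odd n)) / 2 \<notin> \<int>\<^sub>\<le>\<^sub>0"
        "(w + 2 + of_bool (odd n)) / 2 \<notin> \<int>\<^sub>\<le>\<^sub>0"
      proof -
        have "w - 2 + of_bool (odd n) = w + (- 2 + of_bool (odd n))" by simp
        moreover have "w + 2 + of_bool (odd n) = w + (2 + of_bool (odd n))" by (rule add.assoc)
        ultimately show "(w - 2 + of_bool (odd n)) / 2 \<notin> \<int>\<^sub>\<le>\<^sub>0" "(w + of_bool (odd n)) / 2 \<notin> \<int>\<^sub>\<le>\<^sub>0"
            "(w + 2 + of_bool (odd n)) / 2 \<notin> \<int>\<^sub>\<le>\<^sub>0"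
          using elim by (simp_all only: not_False_eq_True)
      qed
      show ?case unfolding f_def e[THEN gegenbauer_mellin_eq_form[OF lam]]
        by (rule gegenbauer_mellin_form_difference_eq[OF lam e(1,2)])
    qed
  qed
  ultimately have "f s = 0" by (rule isCont_eventually_zero)
  thus ?thesis by (simp add: f_def)
qed

section \<open>The generating function\<close>

text \<open>With q = 2 + 2 abs(lam), both coefficients of the recurrence are at most q after
  division by n+2, and q(q+1) + q = q^2 + 2q <= (q+1)^2. Any geometric bound uniform in x suffices,
  since the generating function is only needed for small t.\<close>

lemma gegenbauer_norm_bound:
  assumes x: "x \<in> {0..1}"
  shows "\<bar>gegenbauer lam n x\<bar> \<le> (3 + 2 * \<bar>lam\<bar>) ^ n"
proof (induction n rule: induct_nat_012)
  case 1
  have "\<bar>lam\<bar> * \<bar>x\<bar> \<le> \<bar>lam\<bar> * 1" using x by (intro mult_left_mono) auto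
  thus ?case by (simp add: abs_mult)
next
  case (ge2 n)
  define q where "q = 2 + 2 * \<bar>lam\<bar>"
  define C where "C k = gegenbauer lam k x" for k
  have R: "3 + 2 * \<bar>lam\<bar> = q + 1" and q: "q \<ge> 2" by (simp_all add: q_def)
  have IH: "\<bar>C n\<bar> \<le> (q + 1) ^ n" "\<bar>C (n + 1)\<bar> \<le> (q + 1) ^ (n + 1)"
    using ge2.IH unfolding C_def R by simp_all
  have "(real n + 2) * \<bar>C (n + 2)\<bar> = \<bar>(real n + 2) * C (n + 2)\<bar>" by (simp add: abs_mult)
  also have "\<dots> \<le> \<bar>2 * (lam + real n + 1) * x * C (n + 1)\<bar> + \<bar>(2 * lam + real n) * C n\<bar>"
    unfolding C_def gegenbauer_recurrence by (rule abs_triangle_ineq4)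
  also have "\<dots> \<le> (real n + 2) * q * (q + 1) ^ (n + 1) + (real n + 2) * q * (q + 1) ^ n"
  proof (intro add_mono)
    define c where "c = real n * \<bar>lam\<bar>"
    have nn: "c \<ge> 0" by (simp add: c_def)
    have nq: "(real n + 2) * q = 2 * real n + 2 * c + 4 + 4 * \<bar>lam\<bar>"
      by (simp add: q_def c_def algebra_simps)
    have "\<bar>2 * (lam + real n + 1) * x\<bar> \<le> \<bar>2 * (lam + real n + 1)\<bar> * 1"
      unfolding abs_mult using x by (intro mult_left_mono) auto
    also have "\<dots> \<le> (real n + 2) * q"
    proof -
      have "\<bar>lam + real n + 1\<bar> \<le> \<bar>lam\<bar> + real n + 1" by linarith
      hence "\<bar>2 * (lam + real n + 1)\<bar> \<le> 2 * \<bar>lam\<bar> + 2 * real n + 2" unfolding abs_mult by simp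
      thus ?thesis using nn nq by simp
    qed
    finally show "\<bar>2 * (lam + real n + 1) * x * C (n + 1)\<bar> \<le> (real n + 2) * q * (q + 1) ^ (n + 1)"
      unfolding abs_mult[of _ "C (n + 1)"] using IH q by (intro mult_mono) auto
    have "\<bar>2 * lam + real n\<bar> \<le> (real n + 2) * q" using nn nq by linarith
    thus "\<bar>(2 * lam + real n) * C n\<bar> \<le> (real n + 2) * q * (q + 1) ^ n"
      unfolding abs_mult using IH q by (intro mult_mono) auto
  qed
  also have "\<dots> = (real n + 2) * ((q\<^sup>2 + 2 * q) * (q + 1) ^ n)"
    by (simp add: algebra_simps power2_eq_square)
  also have "\<dots> \<le> (real n + 2) * ((q + 1)\<^sup>2 * (q + 1) ^ n)"
    using q by (intro mult_left_mono mult_right_mono) (simp_all add: power2_eq_square algebra_simps)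
  finally have "\<bar>C (n + 2)\<bar> \<le> (q + 1)\<^sup>2 * (q + 1) ^ n" by simp
  also have "\<dots> = (q + 1) ^ (Suc (Suc n))" by (simp add: power2_eq_square)
  finally show ?case unfolding R C_def by simp
qed simp

text \<open>Both sides of the generating function satisfy $(1 - 2xt + t^2) f' = 2\<lambda>(x - t) f$, which is the recurrence on coefficients.\<close>
lemma gegenbauer_generating_function:
  fixes lam x :: real and t :: complex
  assumes x: "x \<in> {0..1}" and t: "norm t < 1/4"
  shows "(\<lambda>k. of_real (gegenbauer lam k x) * t ^ k) sums ((1 - 2 * t * of_real x + t\<^sup>2) powr (- of_real lam))"
proof -
  define X where "X = complex_of_real x"
  define l where "l = complex_of_real lam"
  define w where "w t = 1 - 2 * t * X + t\<^sup>2" for t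
  define f where "f t = w t powr (- l)" for t
  define A where "A = ball (0 :: complex) (1/4)"
  \<comment> \<open>For norm t < 1/4 the perturbation t^2 - 2tX has norm below 1/2 + 1/16, so the
    base stays in the right half-plane and its principal power is holomorphic.\<close>
  have w_pos: "Re (w t) > 0" if "t \<in> A" for t
  proof -
    have nt: "norm t < 1/4" using that by (simp add: A_def)
    have "norm (2 * t * X) \<le> 2 * norm t * 1"
      unfolding norm_mult X_def using x by (intro mult_mono) auto
    moreover have "norm (t\<^sup>2) \<le> (1/4)\<^sup>2" unfolding norm_power using nt by (intro power_mono) auto
    ultimately have "norm (t\<^sup>2 - 2 * t * X) < 1"
      using norm_triangle_ineq4[of "t\<^sup>2" "2 * t * X"] nt by (simp add: power2_eq_square)
    thus ?thesis using abs_Re_le_cmod[of "t\<^sup>2 - 2 * t * X"] by (simp add: w_def)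
  qed
  have w_notin: "w t \<notin> \<real>\<^sub>\<le>\<^sub>0" if "t \<in> A" for t
    using w_pos[OF that] by (auto simp: complex_nonpos_Reals_iff)
  have deriv_f: "(f has_field_derivative (- l * w t powr (- l - 1) * (2 * t - 2 * X))) (at t)" if "t \<in> A" for t
    unfolding f_def[abs_def]
  proof (rule DERIV_chain2[where f = "\<lambda>z. z powr (- l)" and g = w, OF has_field_derivative_powr[OF w_notin[OF that]]])
    show "(w has_field_derivative (2 * t - 2 * X)) (at t)"
      unfolding w_def[abs_def] by (auto intro!: derivative_eq_intros)
  qed
  have holo: "f holomorphic_on A"
    by (rule holomorphic_onI) (use deriv_f in \<open>auto simp: field_differentiable_def intro: DERIV_subset\<close>)
  define F where "F = fps_expansion f 0"
  have F: "f has_fps_expansion F"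
    unfolding F_def by (rule has_fps_expansion_fps_expansion[OF _ _ holo]) (auto simp: A_def)
  define G where "G = fps_deriv F"
  have G: "deriv f has_fps_expansion G" unfolding G_def by (rule has_fps_expansion_deriv[OF F])
  have L: "(\<lambda>t. deriv f t - 2 * X * (t * deriv f t) + t * (t * deriv f t)) has_fps_expansion
      (G - fps_const (2 * X) * (fps_X * G) + fps_X * (fps_X * G))"
    by (intro fps_expansion_intros G)
  have R: "(\<lambda>t. 2 * l * (X * f t - t * f t)) has_fps_expansion
      (fps_const (2 * l) * (fps_const X * F - fps_X * F))"
    by (intro fps_expansion_intros F)
  have "eventually (\<lambda>t. t \<in> A) (nhds 0)" by (intro eventually_nhds_in_open) (auto simp: A_def)
  hence ev: "eventually (\<lambda>t. deriv f t - 2 * X * (t * deriv f t) + t * (t * deriv f t) =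
      2 * l * (X * f t - t * f t)) (nhds 0)"
  proof eventually_elim
    case (elim t)
    have "w t \<noteq> 0" using w_pos[OF elim] by auto
    hence p: "w t * w t powr (- l - 1) = f t" by (simp add: f_def powr_diff)
    have "deriv f t - 2 * X * (t * deriv f t) + t * (t * deriv f t) = w t * deriv f t"
      by (simp add: w_def algebra_simps power2_eq_square)
    also have "\<dots> = - l * (2 * t - 2 * X) * (w t * w t powr (- l - 1))"
      by (simp add: DERIV_imp_deriv[OF deriv_f[OF elim]])
    also have "\<dots> = 2 * l * (X * f t - t * f t)" unfolding p by (simp add: algebra_simps)
    finally show ?case .
  qed
  have eq: "G - fps_const (2 * X) * (fps_X * G) + fps_X * (fps_X * G) =
      fps_const (2 * l) * (fps_const X * F - fps_X * F)"
    using L R has_fps_expansion_cong[OF ev refl] fps_expansion_unique_complex by blast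
  have F0: "fps_nth F 0 = 1"
    using has_fps_expansion_imp_0_eq_fps_nth_0[OF F] by (simp add: f_def w_def)
  have F1: "fps_nth F 1 = 2 * l * X"
    using arg_cong[OF eq, of "\<lambda>F. fps_nth F 0"] F0 by (simp add: G_def)
  have F2: "(of_nat n + 2) * fps_nth F (n + 2) = 2 * (l + of_nat n + 1) * X * fps_nth F (n + 1) - (2 * l + of_nat n) * fps_nth F n" for n
  proof -
    have "fps_nth G (Suc n) - 2 * X * fps_nth G n + (if n = 0 then 0 else fps_nth G (n - 1)) =
        2 * l * (X * fps_nth F (Suc n) - fps_nth F n)"
      using arg_cong[OF eq, of "\<lambda>F. fps_nth F (Suc n)"] by (cases n) simp_all
    thus ?thesis by (cases n) (simp_all add: G_def algebra_simps)
  qed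
  have coeff: "fps_nth F n = of_real (gegenbauer lam n x)" for n
  proof (induction n rule: induct_nat_012)
    case (ge2 n)
    have n2: "of_nat n + 2 \<noteq> (0 :: complex)"
      using of_nat_neq_0[of "n + 1", where 'a = complex] by (simp add: add_ac)
    have "(of_nat n + 2) * fps_nth F (n + 2) = of_real ((real n + 2) * gegenbauer lam (n + 2) x)"
      unfolding F2 gegenbauer_recurrence using ge2.IH by (simp add: l_def X_def)
    hence "(of_nat n + 2) * fps_nth F (n + 2) = (of_nat n + 2) * of_real (gegenbauer lam (n + 2) x)" by simp
    thus ?case using n2 by simp
  qed (use F0 F1 in \<open>simp_all add: l_def X_def\<close>)
  have holo': "f holomorphic_on eball 0 (ereal (1/4))" using holo by (simp add: A_def)
  have "ereal (norm t) < fps_conv_radius F"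
  proof -
    have "ereal (1/4) \<le> fps_conv_radius F"
      unfolding F_def by (rule conv_radius_fps_expansion[OF holo'])
    thus ?thesis using t by (meson ereal_less_ereal_Ex less_le_trans less_ereal.simps(1))
  qed
  hence "(\<lambda>k. fps_nth F k * t ^ k) sums eval_fps F t" by (rule sums_eval_fps)
  also have "eval_fps F t = f t"
    using eval_fps_expansion'[OF holo', of t] t by (simp add: F_def)
  finally show ?thesis unfolding coeff by (simp add: f_def w_def l_def X_def)
qed

lemma suminf_even_odd:
  fixes f :: "nat \<Rightarrow> 'a :: banach"
  assumes "summable (\<lambda>k. norm (f k))"
  shows "summable (\<lambda>j. f (2 * j))" and "summable (\<lambda>j. f (2 * j + 1))"
    and "(\<Sum>k. f k) = (\<Sum>j. f (2 * j)) + (\<Sum>j. f (2 * j + 1))"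
proof -
  have "summable ((\<lambda>k. norm (f k)) \<circ> (\<lambda>j. 2 * j))" "summable ((\<lambda>k. norm (f k)) \<circ> (\<lambda>j. 2 * j + 1))"
    by (intro summable_reindex assms; simp add: inj_on_def)+
  thus "summable (\<lambda>j. f (2 * j))" "summable (\<lambda>j. f (2 * j + 1))"
    by (auto simp: o_def intro: summable_norm_cancel)
  hence "(\<lambda>j. f (2 * j) + f (2 * j + 1)) sums ((\<Sum>j. f (2 * j)) + (\<Sum>j. f (2 * j + 1)))"
    by (intro sums_add summable_sums)
  moreover have "(\<lambda>j. sum f {j * 2..<j * 2 + 2}) sums (\<Sum>k. f k)"
    by (rule sums_group) (use summable_norm_cancel[OF assms] in \<open>auto intro: summable_sums\<close>)
  moreover have "sum f {j * 2..<j * 2 + 2} = f (2 * j) + f (2 * j + 1)" for j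
    by (simp add: numeral_2_eq_2 mult.commute)
  ultimately show "(\<Sum>k. f k) = (\<Sum>j. f (2 * j)) + (\<Sum>j. f (2 * j + 1))"
    by (simp only: sums_unique2)
qed

text \<open>Summability is required of the scaled series only. At t = 0 the prefactor of the odd
  part vanishes, and summability of that part then says nothing about the unscaled hypergeometric
  series.\<close>

lemma suminf_cmult:
  fixes f :: "nat \<Rightarrow> 'a :: real_normed_field"
  assumes "summable (\<lambda>n. c * f n)"
  shows "(\<Sum>n. c * f n) = c * (\<Sum>n. f n)"
proof (cases "c = 0")
  case False
  from suminf_mult[OF summable_mult_D[OF assms this]] show ?thesis .
qed simp

lemma sum_half_powers_le: "(\<Sum>k<n. (1/2) ^ k) \<le> (2 :: real)"
  by (simp add: sum_gp_strict)

lemma gegenbauer_weight: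
  "1 / complex_of_real ((1 - x\<^sup>2) powr (3/4 - lam/2)) = of_real ((1 - x\<^sup>2) powr (lam/2 + 1/4 - 1))"
proof -
  have "(1 - x\<^sup>2) powr (lam/2 + 1/4 - 1) = (1 - x\<^sup>2) powr (- (3/4 - lam/2))"
    by (rule arg_cong[of _ _ "\<lambda>e. (1 - x\<^sup>2) powr e"]) simp
  thus ?thesis by (simp only: powr_minus inverse_eq_divide of_real_divide of_real_1)
qed

text \<open>The growth bound for the polynomials makes the k-th term at most x powr (Re s - 1) times
  the weight times (1/2)^k, so the Gegenbauer generating function may be integrated term by term
  with twice that first product as majorant.\<close>

lemma gegenbauer_mellin_gf_integral:
  fixes lam :: real and s t :: complex
  assumes lam: "lam > -1/2" and s: "Re s > 0" and t: "norm t < 1 / (4 * (3 + 2 * \<bar>lam\<bar>))"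
  defines "F \<equiv> \<lambda>x::real. 1 / of_real ((1 - x\<^sup>2) powr (3/4 - lam/2))
            * (of_real x powr (s - 1) / (1 - 2 * t * of_real x + t\<^sup>2) powr of_real lam)"
  shows "summable (\<lambda>k. gegenbauer_mellin lam k s * t ^ k)"
    and "set_integrable lborel {0<..<1} F"
    and "gegenbauer_mellin_gf lam s t = (LINT x:{0<..<1}|lborel. F x)"
proof -
  define R where "R = 3 + 2 * \<bar>lam\<bar>"
  define W where "W x = (1 - x\<^sup>2) powr (lam / 2 + 1/4 - 1)" for x :: real
  define g where "g x = 2 * (x powr (Re s - 1) * W x)" for x
  have R: "R \<ge> 3" by (simp add: R_def)
  have Rt: "R * norm t \<le> 1/2"
  proof -
    have "R * norm t \<le> R * (1 / (4 * R))" using t R by (intro mult_left_mono) (auto simp: R_def)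
    thus ?thesis using R by simp
  qed
  have t4: "norm t < 1/4"
  proof -
    have "1 / (4 * R) \<le> 1 / 4" using R by (intro divide_left_mono) auto
    thus ?thesis using t unfolding R_def by linarith
  qed
  have W: "1 / complex_of_real ((1 - x\<^sup>2) powr (3/4 - lam/2)) = of_real (W x)" for x
    unfolding W_def by (rule gegenbauer_weight)
  have g: "set_integrable lborel {0<..<1} g"
    unfolding g_def W_def using s lam by (intro set_integrable_mult_right beta_integral_square_real) auto
  have s': "Re s > - of_bool (odd k)" for k :: nat using s by (cases "even k") auto
  define f where "f k x = gegenbauer_mellin_integrand lam k s x * t ^ k" for k x
  note int = gegenbauer_mellin_integral[OF lam s']
  have f_int: "set_integrable lborel {0<..<1} (f k)" for k
    unfolding f_def using int by (intro set_integrable_mult_left) auto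
  have f_meas: "set_borel_measurable lborel {0<..<1} (f k)" for k
    using f_int[of k] unfolding set_integrable_def set_borel_measurable_def by (rule borel_measurable_integrable)
  have f_eq: "f k x = of_real (W x) * of_real x powr (s - 1) * (of_real (gegenbauer lam k x) * t ^ k)" for k x
    unfolding f_def gegenbauer_mellin_integrand_def W[symmetric] by simp
  have sums: "(\<lambda>k. f k x) sums F x" if "x \<in> {0<..<1}" for x
  proof -
    have "(\<lambda>k. of_real (gegenbauer lam k x) * t ^ k) sums ((1 - 2 * t * of_real x + t\<^sup>2) powr (- of_real lam))"
      using that by (intro gegenbauer_generating_function t4) auto
    hence "(\<lambda>k. f k x) sums (of_real (W x) * of_real x powr (s - 1) * (1 - 2 * t * of_real x + t\<^sup>2) powr (- of_real lam))"
      unfolding f_eq by (rule sums_mult)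
    thus ?thesis unfolding F_def W by (simp add: powr_minus divide_inverse mult_ac)
  qed
  have bound: "(\<Sum>k<n. norm (f k x)) \<le> g x" if x: "x \<in> {0<..<1}" for x n
  proof -
    have "norm (f k x) \<le> (x powr (Re s - 1) * W x) * (1/2) ^ k" for k
    proof -
      have "norm (of_real (gegenbauer lam k x) * t ^ k) \<le> R ^ k * norm t ^ k"
        unfolding norm_mult norm_power R_def norm_of_real
        using x gegenbauer_norm_bound[of x lam k] by (intro mult_right_mono) auto
      also have "\<dots> = (R * norm t) ^ k" by (rule power_mult_distrib[symmetric])
      also have "\<dots> \<le> (1/2) ^ k" using Rt R by (intro power_mono) auto
      finally have "norm (of_real (gegenbauer lam k x) * t ^ k) \<le> (1/2) ^ k" .
      moreover have "norm (f k x) = (x powr (Re s - 1) * W x) * norm (of_real (gegenbauer lam k x) * t ^ k)"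
        unfolding f_eq norm_mult using x by (simp add: norm_powr_real_powr W_def)
      ultimately show ?thesis by (simp add: W_def mult_left_mono)
    qed
    hence "(\<Sum>k<n. norm (f k x)) \<le> (\<Sum>k<n. (x powr (Re s - 1) * W x) * (1/2) ^ k)" by (intro sum_mono)
    also have "\<dots> = (x powr (Re s - 1) * W x) * (\<Sum>k<n. (1/2) ^ k)" by (rule sum_distrib_left[symmetric])
    also have "\<dots> \<le> (x powr (Re s - 1) * W x) * 2"
      by (intro mult_left_mono sum_half_powers_le) (simp add: W_def)
    finally show ?thesis by (simp add: g_def)
  qed
  note * = set_integral_sums_dominated[OF _ f_meas g sums bound]
  show "set_integrable lborel {0<..<1} F" by (rule *(1)) auto
  have "(\<lambda>k. LINT x:{0<..<1}|lborel. f k x) sums (LINT x:{0<..<1}|lborel. F x)" by (rule *(2)) auto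
  moreover have "(LINT x:{0<..<1}|lborel. f k x) = gegenbauer_mellin lam k s * t ^ k" for k
  proof -
    have "gegenbauer_mellin lam k s = gegenbauer_mellin_form lam k s"
      by (rule gegenbauer_mellin_eq_form[OF lam half_plane_not_nonpos_Int[OF s']])
    thus ?thesis using int[of k] unfolding f_def by simp
  qed
  ultimately have "(\<lambda>k. gegenbauer_mellin lam k s * t ^ k) sums (LINT x:{0<..<1}|lborel. F x)" by simp
  thus "summable (\<lambda>k. gegenbauer_mellin lam k s * t ^ k)"
    "gegenbauer_mellin_gf lam s t = (LINT x:{0<..<1}|lborel. F x)"
    by (auto simp: gegenbauer_mellin_gf_def sums_iff)
qed

section \<open>The closed form in terms of 3F2\<close>

lemma hypergeo_3F2_eq:
  "hypergeo_3F2 a1 a2 a3 b1 b2 z = (\<Sum>j. pochhammer a1 j * pochhammer a2 j * pochhammer a3 j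
      / (pochhammer b1 j * pochhammer b2 j * fact j) * z ^ j)"
  by (simp add: hypergeo_3F2_def eval_fps_def)

text \<open>Duplication formulas for (l)_(2j) and for (2j)!. The lower parameter 1/2 of the first
  3F2 comes from the factorial; the odd case below, via (l)_(2j+1) = l (l+1)_(2j), produces
  3/2.\<close>

lemma pochhammer_over_fact_even:
  fixes l :: complex
  shows "pochhammer l (2 * j) / fact (2 * j) =
    pochhammer ((l + 1) / 2) j * pochhammer (l / 2) j / (pochhammer (1/2) j * fact j)"
proof -
  have "pochhammer l (2 * j) = 2 ^ (2 * j) * pochhammer (l / 2) j * pochhammer (l / 2 + 1/2) j"
    using pochhammer_double[of "l / 2" j] by simp
  moreover have "(fact (2 * j) :: complex) = 2 ^ (2 * j) * pochhammer (1/2) j * fact j"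
    by (rule fact_double)
  moreover have "l / 2 + 1/2 = (l + 1) / 2" by (simp add: add_divide_distrib)
  ultimately show ?thesis by (simp add: mult_ac)
qed

lemma pochhammer_over_fact_odd:
  fixes l :: complex
  shows "pochhammer l (2 * j + 1) / fact (2 * j + 1) =
    l * (pochhammer ((l + 1) / 2) j * pochhammer (1 + l / 2) j / (pochhammer (3/2) j * fact j))"
proof -
  have "pochhammer (l + 1) (2 * j) = 2 ^ (2 * j) * pochhammer ((l + 1) / 2) j * pochhammer ((l + 1) / 2 + 1/2) j"
  proof -
    have "2 * ((l + 1) / 2) = l + 1" by simp
    thus ?thesis using pochhammer_double[of "(l + 1) / 2" j] by (simp only: of_nat_power of_nat_numeral)
  qed
  moreover have "(l + 1) / 2 + 1/2 = 1 + l / 2" by (simp add: field_simps)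
  ultimately have p: "pochhammer l (2 * j + 1) =
      2 ^ (2 * j) * (l * (pochhammer ((l + 1) / 2) j * pochhammer (1 + l / 2) j))"
    by (simp add: pochhammer_rec mult_ac)
  have "pochhammer (1/2 :: complex) (Suc j) = 1/2 * pochhammer (3/2) j"
    by (simp add: pochhammer_rec)
  hence "(1/2) * pochhammer (3/2 :: complex) j = pochhammer (1/2) j * (1/2 + of_nat j)"
    by (simp add: pochhammer_Suc)
  hence "pochhammer (3/2 :: complex) j = pochhammer (1/2) j * (2 * of_nat j + 1)"
    by (simp add: field_simps)
  moreover have "(fact (2 * j + 1) :: complex) = (2 * of_nat j + 1) * (2 ^ (2 * j) * pochhammer (1/2) j * fact j)"
    by (simp add: fact_double[symmetric] add.commute)
  ultimately have "(fact (2 * j + 1) :: complex) = 2 ^ (2 * j) * (pochhammer (3/2) j * fact j)"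
    by (simp add: mult_ac)
  thus ?thesis unfolding p by simp
qed

lemma Gamma_quotient_shift:
  fixes z :: complex and a :: real
  assumes "Re z > 0" "a > 0"
  shows "Gamma (z + of_nat j) * rGamma (z + of_nat j + of_real a) =
    Gamma z / Gamma (z + of_real a) * (pochhammer z j / pochhammer (z + of_real a) j)"
proof -
  have n: "w \<notin> \<int>\<^sub>\<le>\<^sub>0" if "Re w > 0" for w :: complex
    using that by (auto elim!: nonpos_Ints_cases)
  have "z \<notin> \<int>\<^sub>\<le>\<^sub>0" "z + of_real a \<notin> \<int>\<^sub>\<le>\<^sub>0" using assms by (auto intro!: n)
  moreover have "z + of_nat j + of_real a = z + of_real a + of_nat j" by (simp add: add_ac)
  ultimately show ?thesis
    by (simp add: pochhammer_Gamma rGamma_inverse_Gamma field_simps Gamma_eq_zero_iff)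
qed

text \<open>Both arguments lie strictly between -pi/2 and pi/2, so their sum stays within the
  principal range and the logarithms add. It serves to factor a power of 1 + t^2 out of the
  kernel.\<close>

lemma powr_mult_Re_pos:
  fixes z w c :: complex
  assumes "Re z > 0" "Re w > 0"
  shows "(z * w) powr c = z powr c * w powr c"
proof -
  have nz: "z \<noteq> 0" "w \<noteq> 0" using assms by auto
  have "\<bar>Im (Ln z)\<bar> < pi / 2" "\<bar>Im (Ln w)\<bar> < pi / 2"
    using Re_Ln_pos_lt[OF nz(1)] Re_Ln_pos_lt[OF nz(2)] assms by auto
  hence "Ln (z * w) = Ln z + Ln w" using nz by (intro Ln_times_simple) (auto simp: abs_less_iff)
  thus ?thesis using nz by (simp add: powr_def distrib_left exp_add)
qed

lemma norm_pochhammer_over_fact_le: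
  fixes l :: complex
  shows "norm (pochhammer l k / fact k) \<le> (1 + norm l) ^ k"
proof (induction k)
  case (Suc k)
  have "norm (l + of_nat k) \<le> norm l + real k"
    using norm_triangle_ineq[of l "of_nat k"] by simp
  also have "\<dots> \<le> (1 + norm l) * (real k + 1)" by (simp add: algebra_simps)
  finally have "norm (l + of_nat k) / (real k + 1) \<le> 1 + norm l" by (simp add: divide_le_eq)
  hence "norm (pochhammer l k / fact k) * (norm (l + of_nat k) / (real k + 1)) \<le> (1 + norm l) ^ k * (1 + norm l)"
    by (intro mult_mono Suc.IH) auto
  moreover have "norm (pochhammer l (Suc k) / fact (Suc k)) =
      norm (pochhammer l k / fact k) * (norm (l + of_nat k) / (real k + 1))"
  proof -
    have "norm (of_nat k + 1 :: complex) = real k + 1"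
      using norm_of_nat[of "Suc k", where 'a = complex] by (simp add: add.commute)
    thus ?thesis by (simp add: pochhammer_Suc norm_mult norm_divide add.commute mult_ac)
  qed
  ultimately show ?case by (simp add: mult.commute)
qed simp

lemma binomial_series_pochhammer:
  fixes l z :: complex
  assumes "norm z < 1"
  shows "(\<lambda>k. pochhammer l k / fact k * z ^ k) sums (1 - z) powr (- l)"
proof -
  have "(\<lambda>k. (- l gchoose k) * (- z) ^ k) sums (1 + (- z)) powr (- l)"
    using assms by (intro gen_binomial_complex) simp
  moreover have "(- l gchoose k) * (- z) ^ k = pochhammer l k / fact k * z ^ k" for k
    using power_mult_distrib[of "- 1" "- z" k] by (simp add: gbinomial_pochhammer)
  ultimately show ?thesis by simp
qed

text \<open>With y = 2t/(1+t^2) the kernel base factors as 1 - 2tx + t^2 = (1+t^2)(1 - yx). The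
  binomial series in yx is integrated term by term, each term being the Beta integral at s+k. Even
  and odd k give the two 3F2, whose argument is y^2.\<close>

lemma gegenbauer_mellin_gf_hypergeo:
  fixes lam :: real and s t :: complex
  assumes lam: "lam > -1/2" "lam \<noteq> 0" and s: "Re s > 0" and t: "norm t < 1 / (4 * (3 + 2 * \<bar>lam\<bar>))"
  shows "gegenbauer_mellin_gf lam s t =
      1 / Gamma (of_real lam)
          * (1 / (1 + t\<^sup>2) powr of_real lam) * (Gamma (of_real (1/4 + lam/2)) / 2)
          * (Gamma (of_real lam) * Gamma (s/2) / Gamma ((s + of_real lam) / 2 + 1/4)
               * hypergeo_3F2 ((of_real lam + 1) / 2) (of_real lam / 2) (s/2)
                   (1/2) ((s + of_real lam) / 2 + 1/4) (4 * t\<^sup>2 / (1 + t\<^sup>2)\<^sup>2)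
             + 2 * t * Gamma (of_real lam + 1) / (1 + t\<^sup>2)
               * (Gamma ((s + 1) / 2) / Gamma ((s + of_real lam) / 2 + 3/4))
               * hypergeo_3F2 ((of_real lam + 1) / 2) (1 + of_real lam / 2) ((s + 1) / 2)
                   (3/2) ((s + of_real lam) / 2 + 3/4) (4 * t\<^sup>2 / (1 + t\<^sup>2)\<^sup>2))"
proof -
  define l where "l = complex_of_real lam"
  define a where "a = lam / 2 + 1/4"
  define W where "W x = (1 - x\<^sup>2) powr (a - 1)" for x :: real
  define y where "y = 2 * t / (1 + t\<^sup>2)"
  define c where "c k = pochhammer l k / fact k" for k
  define I where "I k = Gamma (of_real a) * Gamma ((s + of_nat k) / 2) * rGamma ((s + of_nat k) / 2 + of_real a) / 2" for k
  define f where "f k x = of_real x powr (s + of_nat k - 1) * complex_of_real (W x) * (c k * y ^ k)" for k x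
  define g where "g x = 2 * (x powr (Re s - 1) * W x)" for x
  define F where "F x = of_real (W x) * of_real x powr (s - 1) * (1 - y * of_real x) powr (- l)" for x
  have a: "a > 0" using lam by (simp add: a_def)
  have R: "3 + 2 * \<bar>lam\<bar> \<ge> 3" by simp
  have Rt: "(3 + 2 * \<bar>lam\<bar>) * (4 * norm t) < 1"
    using t by (simp add: less_divide_eq mult_ac split: if_splits)
  have t12: "norm t < 1/12"
  proof -
    have "3 * (4 * norm t) \<le> (3 + 2 * \<bar>lam\<bar>) * (4 * norm t)" by (rule mult_right_mono[OF R]) simp
    hence "3 * (4 * norm t) < 1" using Rt by (rule le_less_trans)
    thus ?thesis by simp
  qed
  have t2: "norm (t\<^sup>2) < 1/2"
  proof -
    have "norm (t\<^sup>2) \<le> (1/12)\<^sup>2" unfolding norm_power using t12 by (intro power_mono) auto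
    thus ?thesis by (simp add: power2_eq_square)
  qed
  have Re1: "Re (1 + t\<^sup>2) > 0" using t2 abs_Re_le_cmod[of "t\<^sup>2"] by simp
  have nz: "1 + t\<^sup>2 \<noteq> 0"
  proof
    assume "1 + t\<^sup>2 = 0"
    with Re1 show False by (simp only: zero_complex.sel)
  qed
  have n1: "norm (1 + t\<^sup>2) \<ge> 1/2"
    using norm_triangle_ineq2[of 1 "- (t\<^sup>2)"] t2 by simp
  have y_le: "norm y \<le> 4 * norm t"
  proof -
    have "norm y = 2 * norm t / norm (1 + t\<^sup>2)" by (simp add: y_def norm_divide norm_mult)
    also have "\<dots> \<le> 2 * norm t / (1/2)" by (intro divide_left_mono n1) (use nz in auto)
    finally show ?thesis by simp
  qed
  \<comment> \<open>The ratio of the majorising geometric series: (l)_k/k! grows at most like (1 +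
    norm l)^k, norm y is at most 4 norm t, and the factor 4 in the bound on t pays for the
    latter.\<close>
  have y_half: "(1 + norm l) * norm y \<le> 1/2"
  proof -
    have "(1 + norm l) * norm y \<le> (1 + \<bar>lam\<bar>) * (4 * norm t)"
      unfolding l_def norm_of_real by (intro mult_left_mono y_le) auto
    also have "\<dots> \<le> ((3 + 2 * \<bar>lam\<bar>) / 2) * (4 * norm t)" by (intro mult_right_mono) auto
    also have "\<dots> \<le> 1/2" using Rt by (simp add: algebra_simps)
    finally show ?thesis .
  qed
  have y1: "norm y \<le> 1/2" using y_le t12 by simp
  have Re2: "Re (1 - y * of_real x) > 0" and yx: "norm (y * of_real x) < 1" if "x \<in> {0<..<1}" for x
  proof -
    have "norm (y * of_real x) \<le> norm y * 1" unfolding norm_mult using that by (intro mult_left_mono) auto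
    thus "norm (y * of_real x) < 1" using y1 by simp
    thus "Re (1 - y * of_real x) > 0" using abs_Re_le_cmod[of "y * of_real x"] by simp
  qed
  have W: "1 / complex_of_real ((1 - x\<^sup>2) powr (3/4 - lam/2)) = of_real (W x)" for x
    unfolding W_def a_def by (rule gegenbauer_weight)
  have F: "1 / of_real ((1 - x\<^sup>2) powr (3/4 - lam/2))
            * (of_real x powr (s - 1) / (1 - 2 * t * of_real x + t\<^sup>2) powr of_real lam) =
         1 / (1 + t\<^sup>2) powr l * F x" if "x \<in> {0<..<1}" for x
  proof -
    have "(1 + t\<^sup>2) * y = 2 * t" using nz by (simp add: y_def)
    hence "1 - 2 * t * of_real x + t\<^sup>2 = (1 + t\<^sup>2) * (1 - y * of_real x)"
      by (simp add: right_diff_distrib mult.assoc[symmetric])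
    hence "(1 - 2 * t * of_real x + t\<^sup>2) powr l = (1 + t\<^sup>2) powr l * (1 - y * of_real x) powr l"
      by (simp only: powr_mult_Re_pos[OF Re1 Re2[OF that]])
    thus ?thesis unfolding W l_def[symmetric] F_def by (simp add: powr_minus divide_inverse mult_ac)
  qed
  have base: "set_integrable lborel {0<..<1} (\<lambda>x. of_real x powr (s + of_nat k - 1) * complex_of_real (W x))"
    "(LINT x:{0<..<1}|lborel. of_real x powr (s + of_nat k - 1) * complex_of_real (W x)) = I k" for k
    using beta_integral_square[of "s + of_nat k" a] s a unfolding W_def I_def by (simp_all add: add_pos_nonneg)
  have f_int: "set_integrable lborel {0<..<1} (f k)" for k
    unfolding f_def by (intro set_integrable_mult_left base)
  have f_meas: "set_borel_measurable lborel {0<..<1} (f k)" for k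
    using f_int[of k] unfolding set_integrable_def set_borel_measurable_def by (rule borel_measurable_integrable)
  have f_eq: "f k x = of_real (W x) * of_real x powr (s - 1) * (c k * (y * of_real x) ^ k)"
    if "x \<in> {0<..<1}" for k x
  proof -
    have "s + of_nat k - 1 = (s - 1) + of_nat k" by simp
    hence "complex_of_real x powr (s + of_nat k - 1) = of_real x powr (s - 1) * of_real x ^ k"
      using that by (simp only: powr_add) (simp add: powr_nat')
    thus ?thesis by (simp add: f_def power_mult_distrib mult_ac)
  qed
  have sums: "(\<lambda>k. f k x) sums F x" if "x \<in> {0<..<1}" for x
    unfolding f_eq[OF that] F_def c_def by (intro sums_mult binomial_series_pochhammer yx that)
  have g: "set_integrable lborel {0<..<1} g"
    unfolding g_def W_def using s a by (intro set_integrable_mult_right beta_integral_square_real) auto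
  have bound: "(\<Sum>k<n. norm (f k x)) \<le> g x" if x: "x \<in> {0<..<1}" for x n
  proof -
    have "norm (f k x) \<le> (x powr (Re s - 1) * W x) * (1/2) ^ k" for k
    proof -
      have "norm (c k * (y * of_real x) ^ k) \<le> (1 + norm l) ^ k * norm y ^ k"
      proof -
        have "norm (y * of_real x) \<le> norm y * 1" unfolding norm_mult using x by (intro mult_left_mono) auto
        thus ?thesis unfolding norm_mult[of "c k"] norm_power unfolding c_def
          by (intro mult_mono norm_pochhammer_over_fact_le power_mono) auto
      qed
      also have "\<dots> = ((1 + norm l) * norm y) ^ k" by (rule power_mult_distrib[symmetric])
      also have "\<dots> \<le> (1/2) ^ k" using y_half by (intro power_mono) auto
      finally have "norm (c k * (y * of_real x) ^ k) \<le> (1/2) ^ k" .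
      moreover have "norm (f k x) = (x powr (Re s - 1) * W x) * norm (c k * (y * of_real x) ^ k)"
        unfolding f_eq[OF x] norm_mult[of "_ * _" "c k * _"] using x
        by (simp add: norm_mult norm_powr_real_powr W_def)
      ultimately show ?thesis by (simp add: W_def mult_left_mono)
    qed
    hence "(\<Sum>k<n. norm (f k x)) \<le> (\<Sum>k<n. (x powr (Re s - 1) * W x) * (1/2) ^ k)" by (intro sum_mono)
    also have "\<dots> = (x powr (Re s - 1) * W x) * (\<Sum>k<n. (1/2) ^ k)" by (rule sum_distrib_left[symmetric])
    also have "\<dots> \<le> (x powr (Re s - 1) * W x) * 2"
      by (intro mult_left_mono sum_half_powers_le) (simp add: W_def)
    finally show ?thesis by (simp add: g_def)
  qed
  note * = set_integral_sums_dominated[OF _ f_meas g sums bound]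
  have If: "(LINT x:{0<..<1}|lborel. f k x) = I k * (c k * y ^ k)" for k
    unfolding f_def set_integral_mult_left base(2) ..
  have summ: "summable (\<lambda>k. norm (I k * (c k * y ^ k)))"
  proof -
    have "summable (\<lambda>k. norm (LINT x:{0<..<1}|lborel. f k x))" by (rule *(3)) auto
    thus ?thesis by (simp only: If)
  qed
  note split = suminf_even_odd[OF summ]
  have "(\<lambda>k. LINT x:{0<..<1}|lborel. f k x) sums (LINT x:{0<..<1}|lborel. F x)" by (rule *(2)) auto
  hence "(LINT x:{0<..<1}|lborel. F x) = (\<Sum>k. I k * (c k * y ^ k))" by (simp add: If sums_iff)
  hence LF: "(LINT x:{0<..<1}|lborel. F x) = (\<Sum>j. I (2 * j) * (c (2 * j) * y ^ (2 * j)))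
      + (\<Sum>j. I (2 * j + 1) * (c (2 * j + 1) * y ^ (2 * j + 1)))"
    by (simp only: split(3))
  have even: "(\<lambda>j. I (2 * j) * (c (2 * j) * y ^ (2 * j))) =
      (\<lambda>j. Gamma (of_real a) / 2 * (Gamma (s / 2) / Gamma (s / 2 + of_real a)) *
        (pochhammer ((l + 1) / 2) j * pochhammer (l / 2) j * pochhammer (s / 2) j
          / (pochhammer (1/2) j * pochhammer (s / 2 + of_real a) j * fact j) * (y\<^sup>2) ^ j))"
  proof
    fix j
    have e: "(s + of_nat (2 * j)) / 2 = s / 2 + of_nat j" by (simp add: add_divide_distrib)
    have "I (2 * j) = Gamma (of_real a) / 2 * (Gamma (s / 2 + of_nat j) * rGamma (s / 2 + of_nat j + of_real a))"
      unfolding I_def e by simp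
    also have "\<dots> = Gamma (of_real a) / 2 *
        (Gamma (s / 2) / Gamma (s / 2 + of_real a) * (pochhammer (s / 2) j / pochhammer (s / 2 + of_real a) j))"
      using s a by (subst Gamma_quotient_shift) simp_all
    finally have I: "I (2 * j) = Gamma (of_real a) / 2 *
        (Gamma (s / 2) / Gamma (s / 2 + of_real a) * (pochhammer (s / 2) j / pochhammer (s / 2 + of_real a) j))" .
    show "I (2 * j) * (c (2 * j) * y ^ (2 * j)) = Gamma (of_real a) / 2 * (Gamma (s / 2) / Gamma (s / 2 + of_real a)) *
        (pochhammer ((l + 1) / 2) j * pochhammer (l / 2) j * pochhammer (s / 2) j
          / (pochhammer (1/2) j * pochhammer (s / 2 + of_real a) j * fact j) * (y\<^sup>2) ^ j)"
      unfolding c_def pochhammer_over_fact_even power_mult I by (simp add: mult_ac)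
  qed
  have odd: "(\<lambda>j. I (2 * j + 1) * (c (2 * j + 1) * y ^ (2 * j + 1))) =
      (\<lambda>j. Gamma (of_real a) / 2 * (l * y * (Gamma ((s + 1) / 2) / Gamma ((s + 1) / 2 + of_real a))) *
        (pochhammer ((l + 1) / 2) j * pochhammer (1 + l / 2) j * pochhammer ((s + 1) / 2) j
          / (pochhammer (3/2) j * pochhammer ((s + 1) / 2 + of_real a) j * fact j) * (y\<^sup>2) ^ j))"
  proof
    fix j
    have e: "(s + of_nat (2 * j + 1)) / 2 = (s + 1) / 2 + of_nat j" by (simp add: add_divide_distrib)
    have "I (2 * j + 1) = Gamma (of_real a) / 2
        * (Gamma ((s + 1) / 2 + of_nat j) * rGamma ((s + 1) / 2 + of_nat j + of_real a))"
      unfolding I_def e by simp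
    also have "\<dots> = Gamma (of_real a) / 2 *
        (Gamma ((s + 1) / 2) / Gamma ((s + 1) / 2 + of_real a)
         * (pochhammer ((s + 1) / 2) j / pochhammer ((s + 1) / 2 + of_real a) j))"
      using s a by (subst Gamma_quotient_shift) simp_all
    finally have I: "I (2 * j + 1) = Gamma (of_real a) / 2 *
        (Gamma ((s + 1) / 2) / Gamma ((s + 1) / 2 + of_real a)
         * (pochhammer ((s + 1) / 2) j / pochhammer ((s + 1) / 2 + of_real a) j))" .
    have y: "y ^ (2 * j + 1) = y * (y\<^sup>2) ^ j" by (simp add: power_mult)
    show "I (2 * j + 1) * (c (2 * j + 1) * y ^ (2 * j + 1)) =
      Gamma (of_real a) / 2 * (l * y * (Gamma ((s + 1) / 2) / Gamma ((s + 1) / 2 + of_real a))) *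
        (pochhammer ((l + 1) / 2) j * pochhammer (1 + l / 2) j * pochhammer ((s + 1) / 2) j
          / (pochhammer (3/2) j * pochhammer ((s + 1) / 2 + of_real a) j * fact j) * (y\<^sup>2) ^ j)"
      unfolding c_def pochhammer_over_fact_odd I y by (simp add: mult_ac)
  qed
  have sa: "(s + l) / 2 + 1/4 = s / 2 + of_real a" "(s + l) / 2 + 3/4 = (s + 1) / 2 + of_real a"
    "complex_of_real (1/4 + lam/2) = of_real a" "4 * t\<^sup>2 / (1 + t\<^sup>2)\<^sup>2 = y\<^sup>2"
    by (simp_all add: l_def a_def y_def add_divide_distrib power_divide power_mult_distrib)
  have LF': "(LINT x:{0<..<1}|lborel. F x) =
      Gamma (of_real a) / 2 * (Gamma (s / 2) / Gamma (s / 2 + of_real a)) *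
        hypergeo_3F2 ((l + 1) / 2) (l / 2) (s / 2) (1/2) (s / 2 + of_real a) (y\<^sup>2)
      + Gamma (of_real a) / 2 * (l * y * (Gamma ((s + 1) / 2) / Gamma ((s + 1) / 2 + of_real a))) *
        hypergeo_3F2 ((l + 1) / 2) (1 + l / 2) ((s + 1) / 2) (3/2) ((s + 1) / 2 + of_real a) (y\<^sup>2)"
    unfolding LF even odd hypergeo_3F2_eq
    by (simp only: suminf_cmult[OF split(1)[unfolded even]] suminf_cmult[OF split(2)[unfolded odd]])
  have Gl: "Gamma (complex_of_real lam) \<noteq> 0" and Gl1: "Gamma (l + 1) = l * Gamma l"
  proof -
    have "l \<notin> \<int>\<^sub>\<le>\<^sub>0"
    proof
      assume "l \<in> \<int>\<^sub>\<le>\<^sub>0"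
      then obtain k where k: "l = of_int k" "k \<le> 0" by (elim nonpos_Ints_cases)
      have "lam = of_int k" using arg_cong[OF k(1), of Re] by (simp add: l_def)
      thus False using lam k(2) by (cases "k = 0") auto
    qed
    thus "Gamma (complex_of_real lam) \<noteq> 0" "Gamma (l + 1) = l * Gamma l"
      by (auto simp: l_def Gamma_eq_zero_iff intro: Gamma_plus1)
  qed
  \<comment> \<open>Multiplies and divides by G = Gamma(lam), which is nonzero; in the odd part lam
    * Gamma(lam) is Gamma(lam + 1).\<close>
  have combine: "Q * (A / 2 * (B / C) * H1 + A / 2 * (l * (2 * t / u) * (D / E)) * H2) =
      1 / G * Q * (A / 2) * (G * B / C * H1 + 2 * t * (l * G) / u * (D / E) * H2)" if "G \<noteq> 0"
    for A B C D E G H1 H2 Q u :: complex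
    using that by (simp add: distrib_left mult_ac)
  have "(LINT x:{0<..<1}|lborel. 1 / of_real ((1 - x\<^sup>2) powr (3/4 - lam/2))
            * (of_real x powr (s - 1) / (1 - 2 * t * of_real x + t\<^sup>2) powr of_real lam)) =
      (LINT x:{0<..<1}|lborel. 1 / (1 + t\<^sup>2) powr l * F x)"
    by (intro set_lebesgue_integral_cong allI impI F) simp_all
  also have "\<dots> = 1 / (1 + t\<^sup>2) powr l * (LINT x:{0<..<1}|lborel. F x)" by (rule set_integral_mult_right)
  finally show ?thesis
    unfolding gegenbauer_mellin_gf_integral(3)[OF lam(1) s t] LF' l_def[symmetric] sa Gl1 y_def[symmetric]
    using combine[OF Gl[folded l_def]] by (simp only: y_def)
qed

theorem theorem2:
  fixes lam :: real
  assumes "lam > -1/2" and "lam \<noteq> 0"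
  shows
    \<comment> \<open>the transforms and their factors are well defined\<close>
    "(\<forall>n s. Re s > - of_bool (odd n) \<longrightarrow>
        set_integrable lborel {0<..<1} (gegenbauer_mellin_integrand lam n s) \<and>
        gegenbauer_mellin lam n s =
          (LINT x:{0<..<1}|lborel. gegenbauer_mellin_integrand lam n s x)) \<and>
     (\<forall>n. gegenbauer_mellin lam n nicely_meromorphic_on UNIV) \<and>
     (\<forall>n s. (s + of_bool (odd n)) / 2 \<notin> \<int>\<^sub>\<le>\<^sub>0 \<longrightarrow>
        gegenbauer_mellin lam n s =
          Gamma (of_real (lam/2 + 1/4)) * Gamma ((s + of_bool (odd n)) / 2)
            / (2 * fact n * Gamma ((s + of_nat n + of_real lam) / 2 + 1/4))
            * gegenbauer_mellin_factor lam n s) \<and>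
     \<comment> \<open>(a)\<close>
     (\<forall>n\<ge>2. \<forall>s. \<not> is_pole (gegenbauer_mellin lam n) s \<longrightarrow>
        \<not> is_pole (gegenbauer_mellin lam (n - 1)) (s + 1) \<longrightarrow>
        \<not> is_pole (gegenbauer_mellin lam (n - 2)) s \<longrightarrow>
        of_nat n * gegenbauer_mellin lam n s =
          2 * (of_real lam + of_nat n - 1) * gegenbauer_mellin lam (n - 1) (s + 1)
          - (2 * of_real lam + of_nat n - 2) * gegenbauer_mellin lam (n - 2) s) \<and>
     \<comment> \<open>(b)\<close>
     (\<exists>\<delta>>0. \<forall>s t :: complex. Re s > 0 \<longrightarrow> norm t < \<delta> \<longrightarrow>
        summable (\<lambda>k. gegenbauer_mellin lam k s * t ^ k) \<and>
        set_integrable lborel {0<..<1} (\<lambda>x::real.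
          1 / of_real ((1 - x\<^sup>2) powr (3/4 - lam/2))
            * (of_real x powr (s - 1) / (1 - 2 * t * of_real x + t\<^sup>2) powr of_real lam)) \<and>
        gegenbauer_mellin_gf lam s t =
          (LINT x:{0<..<1}|lborel.
            1 / of_real ((1 - x\<^sup>2) powr (3/4 - lam/2))
              * (of_real x powr (s - 1) / (1 - 2 * t * of_real x + t\<^sup>2) powr of_real lam)) \<and>
        gegenbauer_mellin_gf lam s t =
          1 / Gamma (of_real lam) \<comment> \<open>normalisation needed for \<open>t = 0\<close> to give the value of \<open>M\<^sub>0\<close> below\<close>
          * (1 / (1 + t\<^sup>2) powr of_real lam) * (Gamma (of_real (1/4 + lam/2)) / 2)
          * (Gamma (of_real lam) * Gamma (s/2) / Gamma ((s + of_real lam) / 2 + 1/4)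
               * hypergeo_3F2 ((of_real lam + 1) / 2) (of_real lam / 2) (s/2)
                   (1/2) ((s + of_real lam) / 2 + 1/4) (4 * t\<^sup>2 / (1 + t\<^sup>2)\<^sup>2)
             + 2 * t * Gamma (of_real lam + 1) / (1 + t\<^sup>2)
               * (Gamma ((s + 1) / 2) / Gamma ((s + of_real lam) / 2 + 3/4))
               * hypergeo_3F2 ((of_real lam + 1) / 2) (1 + of_real lam / 2) ((s + 1) / 2)
                   (3/2) ((s + of_real lam) / 2 + 3/4) (4 * t\<^sup>2 / (1 + t\<^sup>2)\<^sup>2))) \<and>
     \<comment> \<open>(c)\<close>
     (\<forall>n. (\<exists>P :: complex poly. \<forall>s. gegenbauer_mellin_factor lam n s = poly P s) \<and>
          (\<forall>s. gegenbauer_mellin_factor lam n s =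
                 (-1) ^ (n div 2) * gegenbauer_mellin_factor lam n (1 - s))) \<and>
     \<comment> \<open>(d)\<close>
     (\<forall>n s. \<not> is_pole (gegenbauer_mellin lam n) s \<longrightarrow>
        \<not> is_pole (gegenbauer_mellin lam n) (s + 2) \<longrightarrow>
        \<not> is_pole (gegenbauer_mellin lam n) (s - 2) \<longrightarrow>
        (6 - 4 * (of_real lam + 2 * of_real lam * of_nat n + (of_nat n)\<^sup>2)
           - 16 * s + 8 * s * (s + 1)) * gegenbauer_mellin lam n s
        + (- 9 + 4 * (of_nat n + of_real lam)\<^sup>2 + 16 * (s + 2) - 4 * (s + 2) * (s + 3))
           * gegenbauer_mellin lam n (s + 2)
        - 4 * (s - 1) * (s - 2) * gegenbauer_mellin lam n (s - 2) = 0) \<and>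
     (\<forall>s. s/2 \<notin> \<int>\<^sub>\<le>\<^sub>0 \<longrightarrow>
        gegenbauer_mellin lam 0 s =
          Gamma (of_real (lam/2 + 1/4)) * Gamma (s/2)
            / (2 * Gamma ((s + of_real lam) / 2 + 1/4))) \<and>
     (\<forall>s. \<not> is_pole (gegenbauer_mellin lam 1) s \<longrightarrow>
        gegenbauer_mellin lam 1 s = 2 * of_real lam * gegenbauer_mellin lam 0 (s + 1)) \<and>
     \<comment> \<open>(e)\<close>
     (\<forall>n s. gegenbauer_mellin_factor lam n s = 0 \<longrightarrow> Re s = 1/2)"
proof -
  let ?M = "gegenbauer_mellin lam"
  define \<delta> where "\<delta> = 1 / (4 * (3 + 2 * \<bar>lam\<bar>))"
  have \<delta>: "\<delta> > 0" by (simp add: \<delta>_def)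
  \<comment> \<open>Since 2 lam > -1 and 2 lam is nonzero, no factor 2 lam + k vanishes. The zeros
    of p_n are thus exactly those of \<open>gegenbauer_red\<close>; a vanishing (2 lam)_n would make
    every s a zero.\<close>
  have lam2: "pochhammer (2 * complex_of_real lam) n \<noteq> 0" for n
  proof
    assume "pochhammer (2 * complex_of_real lam) n = 0"
    then obtain k where k: "2 * complex_of_real lam = - of_nat k" by (auto simp: pochhammer_eq_0_iff)
    have "Re (2 * complex_of_real lam) = Re (- of_nat k)" by (rule arg_cong[OF k])
    hence "2 * lam = - real k" by simp
    thus False using assms by (cases k) auto
  qed
  have regroup: "A * B * inverse C * (P / (2 * D)) * R = A * B / (2 * D * C) * (P * R)"
    for A B C D P R :: complex by (simp only: divide_inverse inverse_mult_distrib mult_ac)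
  note factor = gegenbauer_mellin_factor_eq[OF assms(1)]
  show ?thesis
  proof (intro conjI)
    show "\<forall>n s. Re s > - of_bool (odd n) \<longrightarrow>
        set_integrable lborel {0<..<1} (gegenbauer_mellin_integrand lam n s) \<and>
        ?M n s = (LINT x:{0<..<1}|lborel. gegenbauer_mellin_integrand lam n s x)"
    proof (intro allI impI)
      fix n :: nat and s :: complex assume h: "Re s > - of_bool (odd n)"
      show "set_integrable lborel {0<..<1} (gegenbauer_mellin_integrand lam n s) \<and>
          ?M n s = (LINT x:{0<..<1}|lborel. gegenbauer_mellin_integrand lam n s x)"
        using gegenbauer_mellin_integral[OF assms(1) h] gegenbauer_mellin_eq_form[OF assms(1) half_plane_not_nonpos_Int[OF h]]
        by (simp only:)
    qed
    show "\<forall>n. ?M n nicely_meromorphic_on UNIV"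
      unfolding gegenbauer_mellin_eq_remove_sings[OF assms(1)]
      by (intro allI remove_sings_nicely_meromorphic gegenbauer_mellin_form_meromorphic)
    show "\<forall>n s. (s + of_bool (odd n)) / 2 \<notin> \<int>\<^sub>\<le>\<^sub>0 \<longrightarrow>
        ?M n s = Gamma (of_real (lam/2 + 1/4)) * Gamma ((s + of_bool (odd n)) / 2)
            / (2 * fact n * Gamma ((s + of_nat n + of_real lam) / 2 + 1/4))
            * gegenbauer_mellin_factor lam n s"
    proof (intro allI impI)
      fix n :: nat and s :: complex assume "(s + of_bool (odd n)) / 2 \<notin> \<int>\<^sub>\<le>\<^sub>0"
      from gegenbauer_mellin_eq_form[OF assms(1) this]
      show "?M n s = Gamma (of_real (lam/2 + 1/4)) * Gamma ((s + of_bool (odd n)) / 2)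
            / (2 * fact n * Gamma ((s + of_nat n + of_real lam) / 2 + 1/4))
            * gegenbauer_mellin_factor lam n s"
        unfolding factor gegenbauer_mellin_form_def rGamma_inverse_Gamma by (simp only: regroup)
    qed
    show "\<forall>n\<ge>2. \<forall>s. \<not> is_pole (?M n) s \<longrightarrow> \<not> is_pole (?M (n - 1)) (s + 1) \<longrightarrow>
        \<not> is_pole (?M (n - 2)) s \<longrightarrow>
        of_nat n * ?M n s = 2 * (of_real lam + of_nat n - 1) * ?M (n - 1) (s + 1)
          - (2 * of_real lam + of_nat n - 2) * ?M (n - 2) s"
    proof (intro allI impI)
      fix n :: nat and s :: complex
      assume n: "n \<ge> 2" and np: "\<not> is_pole (?M n) s" "\<not> is_pole (?M (n - 1)) (s + 1)"
        "\<not> is_pole (?M (n - 2)) s"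
      obtain m where m: "n = m + 2" using n by (metis add.commute le_Suc_ex)
      have m1: "n - 1 = m + 1" "n - 2 = m" using m by simp_all
      have c: "of_nat (m + 2) = of_nat m + (2 :: complex)"
        "of_real lam + (of_nat m + 2) - 1 = of_real lam + of_nat m + (1 :: complex)"
        "2 * of_real lam + (of_nat m + 2) - 2 = 2 * of_real lam + (of_nat m :: complex)" by simp_all
      show "of_nat n * ?M n s = 2 * (of_real lam + of_nat n - 1) * ?M (n - 1) (s + 1)
          - (2 * of_real lam + of_nat n - 2) * ?M (n - 2) s"
        using gegenbauer_mellin_rec[OF assms(1) np[unfolded m1, unfolded m]] unfolding m1 unfolding m
        by (simp only: c)
    qed
    show "\<forall>n. (\<exists>P :: complex poly. \<forall>s. gegenbauer_mellin_factor lam n s = poly P s) \<and>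
          (\<forall>s. gegenbauer_mellin_factor lam n s =
                 (-1) ^ (n div 2) * gegenbauer_mellin_factor lam n (1 - s))"
    proof (intro allI conjI)
      fix n
      obtain P where "\<And>s. gegenbauer_red (of_real lam) n s = poly P s" using gegenbauer_red_poly by blast
      hence "gegenbauer_mellin_factor lam n s = poly (smult (pochhammer (2 * of_real lam) n) P) s" for s
        by (simp add: factor)
      thus "\<exists>P. \<forall>s. gegenbauer_mellin_factor lam n s = poly P s" by blast
      show "gegenbauer_mellin_factor lam n s = (-1) ^ (n div 2) * gegenbauer_mellin_factor lam n (1 - s)" for s
        unfolding factor gegenbauer_red_reflect[OF two_lam_nonzero[OF assms(1)]]
        by (simp add: mult.left_commute)
    qed
    show "\<forall>n s. \<not> is_pole (?M n) s \<longrightarrow> \<not> is_pole (?M n) (s + 2) \<longrightarrow> \<not> is_pole (?M n) (s - 2) \<longrightarrow>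
        (6 - 4 * (of_real lam + 2 * of_real lam * of_nat n + (of_nat n)\<^sup>2)
           - 16 * s + 8 * s * (s + 1)) * ?M n s
        + (- 9 + 4 * (of_nat n + of_real lam)\<^sup>2 + 16 * (s + 2) - 4 * (s + 2) * (s + 3)) * ?M n (s + 2)
        - 4 * (s - 1) * (s - 2) * ?M n (s - 2) = 0"
      by (intro allI impI gegenbauer_mellin_difference_eq[OF assms(1)])
    show "\<forall>s. s/2 \<notin> \<int>\<^sub>\<le>\<^sub>0 \<longrightarrow> ?M 0 s =
          Gamma (of_real (lam/2 + 1/4)) * Gamma (s/2) / (2 * Gamma ((s + of_real lam) / 2 + 1/4))"
    proof (intro allI impI)
      fix s :: complex assume "s/2 \<notin> \<int>\<^sub>\<le>\<^sub>0"
      hence "?M 0 s = gegenbauer_mellin_form lam 0 s" by (intro gegenbauer_mellin_eq_form[OF assms(1)]) simp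
      thus "?M 0 s = Gamma (of_real (lam/2 + 1/4)) * Gamma (s/2) / (2 * Gamma ((s + of_real lam) / 2 + 1/4))"
        by (simp only: gegenbauer_mellin_form_0)
    qed
    show "\<forall>s. \<not> is_pole (?M 1) s \<longrightarrow> ?M 1 s = 2 * of_real lam * ?M 0 (s + 1)"
      by (intro allI impI gegenbauer_mellin_1[OF assms])
    show "\<forall>n s. gegenbauer_mellin_factor lam n s = 0 \<longrightarrow> Re s = 1/2"
      unfolding factor using lam2 gegenbauer_red_zeros[OF assms(1)] by auto
    show "\<exists>\<delta>>0. \<forall>s t :: complex. Re s > 0 \<longrightarrow> norm t < \<delta> \<longrightarrow>
        summable (\<lambda>k. gegenbauer_mellin lam k s * t ^ k) \<and>
        set_integrable lborel {0<..<1} (\<lambda>x::real.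
          1 / of_real ((1 - x\<^sup>2) powr (3/4 - lam/2))
            * (of_real x powr (s - 1) / (1 - 2 * t * of_real x + t\<^sup>2) powr of_real lam)) \<and>
        gegenbauer_mellin_gf lam s t =
          (LINT x:{0<..<1}|lborel.
            1 / of_real ((1 - x\<^sup>2) powr (3/4 - lam/2))
              * (of_real x powr (s - 1) / (1 - 2 * t * of_real x + t\<^sup>2) powr of_real lam)) \<and>
        gegenbauer_mellin_gf lam s t =
          1 / Gamma (of_real lam)
          * (1 / (1 + t\<^sup>2) powr of_real lam) * (Gamma (of_real (1/4 + lam/2)) / 2)
          * (Gamma (of_real lam) * Gamma (s/2) / Gamma ((s + of_real lam) / 2 + 1/4)
               * hypergeo_3F2 ((of_real lam + 1) / 2) (of_real lam / 2) (s/2)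
                   (1/2) ((s + of_real lam) / 2 + 1/4) (4 * t\<^sup>2 / (1 + t\<^sup>2)\<^sup>2)
             + 2 * t * Gamma (of_real lam + 1) / (1 + t\<^sup>2)
               * (Gamma ((s + 1) / 2) / Gamma ((s + of_real lam) / 2 + 3/4))
               * hypergeo_3F2 ((of_real lam + 1) / 2) (1 + of_real lam / 2) ((s + 1) / 2)
                   (3/2) ((s + of_real lam) / 2 + 3/4) (4 * t\<^sup>2 / (1 + t\<^sup>2)\<^sup>2))"
      by (intro exI[of _ \<delta>] conjI[OF \<delta>] allI impI conjI gegenbauer_mellin_gf_integral[OF assms(1)]
          gegenbauer_mellin_gf_hypergeo[OF assms]; simp only: \<delta>_def)
  qed
qed

end
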